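(* Let $T$ be a tree with $\kappa_{\mathrm m}(T)=2$, $M_T=fg$ with $f,g\in\mathbb Z[x]$ distinct, monic and irreducible over $\mathbb Q$, and let $\Gamma_T=\Gamma_f+\Gamma_g$ be the canonical factor-coronal decomposition, with factor moments $w_k^{(f)},w_k^{(g)}$ ($k\ge0$). For an ordering $(p,q)\in\{(f,g),(g,f)\}$ put $n_p:=w_0^{(p)}$, $n_q:=w_0^{(q)}$, and consider the conditions: (i) $w_k^{(p)},w_k^{(q)}\in\mathbb Z_{\ge0}$ for all $k\ge0$, $n_p\ge1$ and $n_q\ge4$; (ii) $w_1^{(p)}-2w_0^{(p)}=-2$ and $w_1^{(q)}-2w_0^{(q)}=0$; (iii) $w_2^{(p)}$ and $w_2^{(q)}$ are even, $w_2^{(p)}\ge\max\{0,4n_p-6\}$ and $w_2^{(q)}\ge4n_q$; (iv) if $p(x)=x-a$, then $(a,n_p)\in\{(0,1),(1,2)\}$; if $q(x)=x-a$, then $a=2$ and $n_q$ is even. If neither ordering $(p,q)=(f,g)$ nor $(p,q)=(g,f)$ satisfies conditions (i)–(iv), then every graph generalized cospectral with $T$ is a tree.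
   Context: All graphs are finite, simple and undirected. For a graph $G$, $A(G)$ is its adjacency matrix, $\phi_G(x)=\det(xI-A(G))$, $\mathbf 1$ is the all-one vector, and the coronal is $\Gamma_G(x)=\mathbf 1^{T}(xI-A(G))^{-1}\mathbf 1$. Two graphs are generalized cospectral if they have the same adjacency spectrum and their complements have the same adjacency spectrum. An adjacency eigenvalue is main if its eigenspace is not orthogonal to $\mathbf 1$; the main polynomial $M_G(x)$ is the product of $(x-\lambda)$ over the distinct main eigenvalues $\lambda$ of $G$; it divides $\phi_G$ in $\mathbb Z[x]$ and is the monic reduced denominator of $\Gamma_G$. If $\phi_G=\prod_{i=1}^r f_i^{m_i}$ with $f_i$ distinct, monic and irreducible over $\mathbb Q$, the main-factor multiplicity is $\kappa_{\mathrm m}(G):=\sum_{i:\,f_i\mid M_G} m_i$. When $T$ is a tree with $\kappa_{\mathrm m}(T)=2$, $M_T=fg$ with $f,g$ distinct monic irreducible. The canonical factor-coronal decomposition is the unique proper partial-fraction decomposition $\Gamma_T=\Gamma_f+\Gamma_g$ with $\Gamma_f=A/f$, $\Gamma_g=B/g$, $A,B\in\mathbb Q[x]$, $\deg A<\deg f$, $\deg B<\deg g$. The factor moments are defined by the Laurent expansion at infinity $\Gamma_h(x)=\sum_{k\ge0} w_k^{(h)}x^{-k-1}$, $h\in\{f,g\}$. *)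

theory Defs
  imports
    "Graph_Theory.Graph_Theory"
    "Jordan_Normal_Form.Char_Poly"
    "Jordan_Normal_Form.Gauss_Jordan_Elimination"
    "HOL-Computational_Algebra.Computational_Algebra"
    "HOL-Computational_Algebra.Field_as_Ring"
begin

text \<open>
  A finite simple undirected graph is a \<^typ>\<open>'a pair_pre_digraph\<close> satisfying the locale predicate
  \<^locale>\<open>pair_graph\<close>: each undirected edge is a pair of opposite arcs.
\<close>

text \<open>
  In a symmetric digraph every edge run back and forth is a directed cycle of length 2, so the
  library's \<^const>\<open>tree\<close> does not describe undirected trees; a cycle of an undirected graph has at
  least three edges. The library's \<^const>\<open>Digraph_Component.connected\<close> excludes the null graph.
\<close>

definition undirected_cycle :: "'a pair_pre_digraph \<Rightarrow> ('a \<times> 'a) list \<Rightarrow> bool" where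
  "undirected_cycle G c \<longleftrightarrow> pre_digraph.cycle (with_proj G) c \<and> length c \<ge> 3"

definition is_tree :: "'a pair_pre_digraph \<Rightarrow> bool" where
  "is_tree G \<longleftrightarrow>
     pair_graph G \<and> Digraph_Component.connected (with_proj G) \<and> (\<nexists>c. undirected_cycle G c)"

definition complement_graph :: "'a pair_pre_digraph \<Rightarrow> 'a pair_pre_digraph" where
  "complement_graph G =
     \<lparr> pverts = pverts G,
       parcs = {(u, v). u \<in> pverts G \<and> v \<in> pverts G \<and> u \<noteq> v \<and> (u, v) \<notin> parcs G} \<rparr>"

text \<open>
  Matrices are indexed by \<open>{0..<n}\<close>, so the adjacency matrix refers to an arbitrary but fixed
  enumeration of the vertices; another one conjugates the matrix by a permutation matrix and changes
  none of the invariants below.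
\<close>

definition vertex_list :: "'a pair_pre_digraph \<Rightarrow> 'a list" where
  "vertex_list G = (SOME xs. distinct xs \<and> set xs = pverts G)"

definition adjacency_matrix :: "'a pair_pre_digraph \<Rightarrow> 'b::zero_neq_one mat" where
  "adjacency_matrix G =
     (let xs = vertex_list G; n = card (pverts G)
      in mat n n (\<lambda>(i, j). if (xs ! i, xs ! j) \<in> parcs G then 1 else 0))"

definition ones_vec :: "nat \<Rightarrow> 'b::one vec" where
  "ones_vec n = vec n (\<lambda>_. 1)"

text \<open>
  Eigenvalues are counted with multiplicity; taking them over \<open>\<complex>\<close> loses none of them, and since the
  matrix is real symmetric they are all real.
\<close>

definition adjacency_spectrum :: "'a pair_pre_digraph \<Rightarrow> complex multiset" where
  "adjacency_spectrum G = proots (char_poly (adjacency_matrix G))"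

definition generalized_cospectral :: "'a pair_pre_digraph \<Rightarrow> 'c pair_pre_digraph \<Rightarrow> bool" where
  "generalized_cospectral G H \<longleftrightarrow>
     adjacency_spectrum G = adjacency_spectrum H \<and>
     adjacency_spectrum (complement_graph G) = adjacency_spectrum (complement_graph H)"

definition main_eigenvalue :: "'a pair_pre_digraph \<Rightarrow> real \<Rightarrow> bool" where
  "main_eigenvalue G l \<longleftrightarrow>
     (\<exists>v. eigenvector (adjacency_matrix G) v l \<and> ones_vec (card (pverts G)) \<bullet> v \<noteq> 0)"

definition main_poly :: "'a pair_pre_digraph \<Rightarrow> real poly" where
  "main_poly G = (\<Prod>l | main_eigenvalue G l. [:- l, 1:])"

text \<open>
  The index set consists of the monic irreducible factors over \<open>\<rat>\<close> of the characteristic polynomial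
  that divide the main polynomial. Divisibility is tested in \<open>\<real>[x]\<close>, where the main polynomial lives.
\<close>

definition main_factor_multiplicity :: "'a pair_pre_digraph \<Rightarrow> nat" where
  "main_factor_multiplicity G =
     (let phi = char_poly (adjacency_matrix G) :: rat poly
      in \<Sum>h | lead_coeff h = 1 \<and> irreducible h \<and> h dvd phi \<and> map_poly of_rat h dvd main_poly G.
           multiplicity h phi)"

text \<open>
  The coronal as an element of the field \<open>\<rat>(x)\<close>. The matrix \<open>xI - A\<close> is invertible over this field,
  because its determinant is a monic polynomial.
\<close>

definition coronal :: "'a pair_pre_digraph \<Rightarrow> rat poly fract" where
  "coronal G =
     (let M = map_mat to_fract (char_poly_matrix (adjacency_matrix G));
          u = ones_vec (card (pverts G))
      in u \<bullet> (the (mat_inverse M) *\<^sub>v u))"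

definition factor_coronal_decomposition ::
  "'a pair_pre_digraph \<Rightarrow> int poly \<Rightarrow> int poly \<Rightarrow> rat poly fract \<Rightarrow> rat poly fract \<Rightarrow> bool" where
  "factor_coronal_decomposition G f g \<Gamma>f \<Gamma>g \<longleftrightarrow>
     coronal G = \<Gamma>f + \<Gamma>g \<and>
     (\<exists>A B. degree A < degree f \<and> degree B < degree g \<and>
        \<Gamma>f = Fract A (of_int_poly f) \<and> \<Gamma>g = Fract B (of_int_poly g))"

text \<open>
  Expansion at infinity is the embedding of \<open>\<rat>(x)\<close> into the Laurent series in \<open>t = 1/x\<close> that
  substitutes \<open>1/t\<close> for \<open>x\<close> in numerator and denominator.
\<close>

definition poly_at_infinity :: "rat poly \<Rightarrow> rat fls" where
  "poly_at_infinity p = poly (map_poly fls_const p) fls_X_inv"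

definition laurent_at_infinity :: "rat poly fract \<Rightarrow> rat fls" where
  "laurent_at_infinity r =
     (case quot_of_fract r of (a, b) \<Rightarrow> poly_at_infinity a / poly_at_infinity b)"

definition moment :: "rat poly fract \<Rightarrow> nat \<Rightarrow> rat" where
  "moment r k = fls_nth (laurent_at_infinity r) (int k + 1)"

definition even_rat :: "rat \<Rightarrow> bool" where
  "even_rat w \<longleftrightarrow> (\<exists>m::int. even m \<and> w = of_int m)"

text \<open>
  Conditions (i) to (iv) for an ordered pair of factors, given with the moment sequences \<open>wp\<close> and
  \<open>wq\<close>; thus \<open>wp 0\<close> and \<open>wq 0\<close> are \<open>n\<^sub>p\<close> and \<open>n\<^sub>q\<close>.
\<close>

definition moment_conditions ::
  "int poly \<Rightarrow> (nat \<Rightarrow> rat) \<Rightarrow> int poly \<Rightarrow> (nat \<Rightarrow> rat) \<Rightarrow> bool" where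
  "moment_conditions p wp q wq \<longleftrightarrow>
     ((\<forall>k. wp k \<in> \<nat> \<and> wq k \<in> \<nat>) \<and> wp 0 \<ge> 1 \<and> wq 0 \<ge> 4) \<and>
     (wp 1 - 2 * wp 0 = - 2 \<and> wq 1 - 2 * wq 0 = 0) \<and>
     (even_rat (wp 2) \<and> even_rat (wq 2) \<and>
        wp 2 \<ge> max 0 (4 * wp 0 - 6) \<and> wq 2 \<ge> 4 * wq 0) \<and>
     ((\<forall>a. p = [:- a, 1:] \<longrightarrow> (a, wp 0) \<in> {(0, 1), (1, 2)}) \<and>
      (\<forall>a. q = [:- a, 1:] \<longrightarrow> a = 2 \<and> even_rat (wq 0)))"

end

theory Submission
  imports Defs
begin

text \<open>
  Generalized cospectrality determines \<open>\<phi>\<close> and the coronal, hence all walk counts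
  \<open>1\<^sup>T A\<^sup>k 1\<close>, so \<open>H\<close> has as many vertices and edges as \<open>T\<close> and \<open>(fg)(A) 1 = 0\<close> holds for
  \<open>H\<close> as well, because \<open>|P(A) 1|\<^sup>2\<close> is linear in the walk counts. If \<open>H\<close> is not a tree, it
  is disconnected. Every union of components carries \<open>f\<close> or \<open>g\<close> in its characteristic polynomial,
  and both are simple factors of \<open>\<phi>\<close>; so \<open>H\<close> has exactly two components, the all-one
  vector of one is annihilated by \<open>f\<close> and that of the other by \<open>g\<close>. As \<open>f\<close> and \<open>g\<close> are
  coprime, the factor moments are the walk counts of the two components. Counting edges, one
  component is a tree and the other is unicyclic, and (i) to (iv) are statements about their degrees.
\<close>

subsection \<open>Bridges, components and cycles\<close>


text \<open>The delicate case is a 2-regular unicyclic component: \<open>n_q \<ge> 4\<close> must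
  exclude the triangle, and (iv) wants an even order. Both rest on the bipartiteness of
  \<open>T\<close>. The spectrum of \<open>T\<close>, hence that of \<open>H\<close>, is symmetric
  about 0, so the eigenvalue 2 of a cycle component forces -2 to occur somewhere in
  \<open>H\<close>. It cannot belong to the tree component, which is bipartite and would then have
  the eigenvalue 2 as well, while \<open>q\<close> vanishes at 2 and is coprime to the
  characteristic polynomial of that component. So -2 is an eigenvalue of the cycle, which is
  therefore even. Vectors are functions on the whole vertex type and components enter by restricting
  such functions, so one adjacency operator serves the graph and all unions of its components;
  matrices appear only where characteristic polynomials and the coronal do. Counting is done in
  arcs: a tree on n vertices has 2n - 2 of them.\<close>

locale sgraph =
  fixes V :: "'v set" and E :: "('v \<times> 'v) set"
  assumes finite_V: "finite V" and E_V: "E \<subseteq> V \<times> V"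
    and sym_E: "sym E" and irrefl_E: "irrefl E"
begin

lemma finite_E: "finite E"
  using finite_subset[OF E_V] finite_V by auto

lemma E_D: "(u, v) \<in> E \<Longrightarrow> u \<in> V \<and> v \<in> V \<and> u \<noteq> v \<and> (v, u) \<in> E"
  using E_V sym_E irrefl_E by (auto simp: sym_def irrefl_def)

lemma sgraph_delete_edge: "sgraph V (E - {(u, v), (v, u)})"
  using finite_V E_V sym_E irrefl_E by unfold_locales (auto simp: sym_def irrefl_def)

lemma card_delete_edge:
  assumes "(u, v) \<in> E"
  shows "card E = card (E - {(u, v), (v, u)}) + 2"
proof -
  have "card (E - {(u, v), (v, u)}) = card E - card {(u, v), (v, u)}"
    using E_D[OF assms] assms by (intro card_Diff_subset) auto
  moreover have "card {(u, v), (v, u)} \<le> card E"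
    using E_D[OF assms] assms finite_E by (intro card_mono) auto
  moreover have "card {(u, v), (v, u)} = 2" using E_D[OF assms] by auto
  ultimately show ?thesis by linarith
qed

lemma rtrancl_sym: "(u, v) \<in> E\<^sup>* \<Longrightarrow> (v, u) \<in> E\<^sup>*"
  using sym_rtrancl[OF sym_E] by (auto simp: sym_def)

lemma rtrancl_V: "(u, v) \<in> E\<^sup>* \<Longrightarrow> u \<in> V \<longleftrightarrow> v \<in> V"
  by (induction rule: rtrancl_induct) (use E_V in auto)

end

text \<open>Acyclicity in a form that is inherited by subsets and suits induction over the edges.\<close>

definition all_bridges :: "('v \<times> 'v) set \<Rightarrow> bool" where
  "all_bridges E \<longleftrightarrow> (\<forall>(u, v) \<in> E. (u, v) \<notin> (E - {(u, v), (v, u)})\<^sup>*)"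

definition comps :: "'v set \<Rightarrow> ('v \<times> 'v) set \<Rightarrow> 'v set set" where
  "comps V E = (\<lambda>v. E\<^sup>* `` {v}) ` V"

lemma all_bridges_mono:
  assumes "all_bridges E" "F \<subseteq> E"
  shows "all_bridges F"
proof -
  have "(F - {(u, v), (v, u)})\<^sup>* \<subseteq> (E - {(u, v), (v, u)})\<^sup>*" for u v
    using assms(2) by (intro rtrancl_mono) auto
  then show ?thesis using assms unfolding all_bridges_def by blast
qed

context sgraph begin

text \<open>Both arcs of an edge go at once, so that every intermediate graph is an
  \<open>sgraph\<close> on the same vertices and the bridge lemmas apply to it.\<close>

lemma edge_induct [case_names empty insert]:
  assumes "P {}"
    and "\<And>F u v. F \<subseteq> E \<Longrightarrow> sgraph V F \<Longrightarrow> (u, v) \<in> F \<Longrightarrow> P (F - {(u, v), (v, u)}) \<Longrightarrow> P F"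
  shows "P E"
proof -
  have "F \<subseteq> E \<Longrightarrow> sgraph V F \<Longrightarrow> P F" if "finite F" for F
    using that
  proof (induction F rule: finite_psubset_induct)
    case (psubset F)
    show ?case
    proof (cases "F = {}")
      case False
      then obtain u v where uv: "(u, v) \<in> F" by auto
      have "P (F - {(u, v), (v, u)})"
        using psubset.prems uv sgraph.sgraph_delete_edge[OF psubset.prems(2)]
        by (intro psubset.IH) auto
      then show ?thesis using assms(2) psubset.prems uv by blast
    qed (use assms in auto)
  qed
  then show ?thesis using finite_E sgraph_axioms by auto
qed

context
  fixes u v
  assumes uv: "(u, v) \<in> E"
begin

private abbreviation "F \<equiv> E - {(u, v), (v, u)}"

interpretation F: sgraph V F by (rule sgraph_delete_edge)

lemma rtrancl_non_bridge:
  assumes "(u, v) \<in> F\<^sup>*"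
  shows "E\<^sup>* = F\<^sup>*"
proof
  have "E \<subseteq> F\<^sup>*" using assms F.rtrancl_sym[OF assms] by auto
  then show "E\<^sup>* \<subseteq> F\<^sup>*" by (rule rtrancl_subset_rtrancl)
qed (rule rtrancl_mono, auto)

text \<open>Putting the edge back merges the classes of \<open>u\<close> and \<open>v\<close> and
  leaves every other class alone.\<close>

lemma rtrancl_bridge:
  "E\<^sup>* `` {w} = (if w \<in> F\<^sup>* `` {u} \<union> F\<^sup>* `` {v} then F\<^sup>* `` {u} \<union> F\<^sup>* `` {v} else F\<^sup>* `` {w})"
proof -
  obtain D where D: "D = F" by auto
  \<comment> \<open>The two arcs are inserted one after the other, so \<open>rtrancl_insert\<close>
    applies twice; \<open>r\<close> is an equivalence relation, which collapses the nested
    cases.\<close>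
  have E: "E = insert (u, v) (insert (v, u) D)" using uv E_D unfolding D by auto
  define r where "r x y \<longleftrightarrow> (x, y) \<in> D\<^sup>*" for x y
  have r: "r x x" "r x y \<Longrightarrow> r y x" "r x y \<Longrightarrow> r y z \<Longrightarrow> r x z" for x y z
    unfolding r_def D using F.rtrancl_sym by (auto intro: rtrancl_trans)
  have E': "(w, y) \<in> E\<^sup>* \<longleftrightarrow> r w y \<or> r w u \<and> r v y \<or> r w v \<and> r u y" for y
    unfolding E rtrancl_insert mem_Collect_eq Un_iff prod.case r_def[symmetric]
    using r(3)[of w u y] r(3)[of w v y] by (auto simp: r(1))
  show ?thesis
  proof (cases "r u w \<or> r v w")
    case True
    have "(w, y) \<in> E\<^sup>* \<longleftrightarrow> r u y \<or> r v y" for y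
      using True
    proof
      assume "r u w"
      then have "r w y \<longleftrightarrow> r u y" "r w u" "r w v \<longleftrightarrow> r u v" by (metis r)+
      then show ?thesis unfolding E' by (metis r)
    next
      assume "r v w"
      then have "r w y \<longleftrightarrow> r v y" "r w v" "r w u \<longleftrightarrow> r v u" by (metis r)+
      then show ?thesis unfolding E' by (metis r)
    qed
    then show ?thesis using True by (auto simp: r_def D)
  next
    case False
    then have "(w, y) \<in> E\<^sup>* \<longleftrightarrow> r w y" for y unfolding E' using r(2) by blast
    then show ?thesis using False by (auto simp: r_def D)
  qed
qed

text \<open>\<open>R\<close> collects the classes that contain neither end point and is common to
  both graphs; deleting the bridge splits the one class \<open>?U \<union> ?W\<close> into
  \<open>?U\<close> and \<open>?W\<close>.\<close>

lemma card_comps_bridge: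
  assumes "(u, v) \<notin> F\<^sup>*"
  shows "card (comps V F) = card (comps V E) + 1"
proof -
  let ?U = "F\<^sup>* `` {u}" and ?W = "F\<^sup>* `` {v}"
  have V: "u \<in> V" "v \<in> V" using E_D[OF uv] by auto
  have eq: "F\<^sup>* `` {w} = F\<^sup>* `` {x}" if "(x, w) \<in> F\<^sup>*" for w x
    using that F.rtrancl_sym by (auto intro: rtrancl_trans)
  have UW: "?U \<noteq> ?W" using assms by auto
  define R where "R = comps V F - {?U, ?W}"
  have fin: "finite R" unfolding R_def comps_def using finite_V by auto
  have 1: "comps V F = insert ?U (insert ?W R)"
    unfolding R_def comps_def using V by auto
  have inR: "F\<^sup>* `` {w} \<in> R" if "w \<in> V" "w \<notin> ?U \<union> ?W" for w
  proof -
    have "w \<in> F\<^sup>* `` {w}" by auto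
    then have "F\<^sup>* `` {w} \<noteq> ?U" "F\<^sup>* `` {w} \<noteq> ?W" using that(2) by auto
    then show ?thesis unfolding R_def comps_def using that by auto
  qed
  have 2: "comps V E = insert (?U \<union> ?W) R"
  proof
    show "comps V E \<subseteq> insert (?U \<union> ?W) R"
      unfolding comps_def[of V E] using inR by (auto simp: rtrancl_bridge)
    have "?U \<union> ?W \<in> comps V E"
      unfolding comps_def using V rtrancl_bridge[of u] by (auto simp: image_iff intro!: bexI[of _ u])
    moreover have "C \<in> comps V E" if C: "C \<in> R" for C
    proof -
      obtain w where w: "w \<in> V" "C = F\<^sup>* `` {w}" "C \<noteq> ?U" "C \<noteq> ?W"
        using C unfolding R_def comps_def by auto
      then have "w \<notin> ?U" "w \<notin> ?W" using eq by auto
      then show ?thesis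
        unfolding comps_def using w rtrancl_bridge[of w] by (auto simp: image_iff intro!: bexI[of _ w])
    qed
    ultimately show "insert (?U \<union> ?W) R \<subseteq> comps V E" by auto
  qed
  have 3: "?U \<union> ?W \<notin> R"
  proof
    assume "?U \<union> ?W \<in> R"
    then obtain w where w: "?U \<union> ?W = F\<^sup>* `` {w}" "F\<^sup>* `` {w} \<noteq> ?U"
      unfolding R_def comps_def by auto
    then have "(w, u) \<in> F\<^sup>*" by auto
    from eq[OF this] w show False by auto
  qed
  show ?thesis unfolding 1 2 using fin 3 UW by (simp add: R_def)
qed

end

lemma comps_non_bridge:
  assumes "(u, v) \<in> E" "(u, v) \<in> (E - {(u, v), (v, u)})\<^sup>*"
  shows "comps V E = comps V (E - {(u, v), (v, u)})"
  unfolding comps_def rtrancl_non_bridge[OF assms] ..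

end

lemma comps_empty: "card (comps V {}) = card V"
  unfolding comps_def by (auto simp: inj_on_def intro!: card_image)

context sgraph begin

text \<open>Deleting an edge creates at most one new component. As \<open>card E\<close> counts
  arcs, this is the bound n <= m + c in doubled form.\<close>

lemma card_edges_ge: "2 * card V \<le> card E + 2 * card (comps V E)"
proof (induction rule: edge_induct)
  case (insert F u v)
  interpret F: sgraph V F by fact
  have "card (comps V (F - {(u, v), (v, u)})) \<le> card (comps V F) + 1"
    using F.comps_non_bridge[OF insert(3)] F.card_comps_bridge[OF insert(3)]
    by (metis le_add1 order_refl)
  then show ?case
    using insert(4) F.card_delete_edge[OF insert(3)] by linarith
qed (simp add: comps_empty)

lemma card_edges_all_bridges:
  "all_bridges E \<Longrightarrow> 2 * card V = card E + 2 * card (comps V E)"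
proof (induction rule: edge_induct)
  case (insert F u v)
  interpret F: sgraph V F by fact
  have "all_bridges (F - {(u, v), (v, u)})" using all_bridges_mono[OF insert(5)] by auto
  moreover have "(u, v) \<notin> (F - {(u, v), (v, u)})\<^sup>*"
    using insert(3,5) unfolding all_bridges_def by auto
  ultimately show ?case
    using insert(4) F.card_delete_edge[OF insert(3)] F.card_comps_bridge[OF insert(3)] by linarith
qed (simp add: comps_empty)

text \<open>Supplies the bipartiteness of trees, both for \<open>T\<close> and for the tree
  component of \<open>H\<close>.\<close>

lemma two_colouring:
  "all_bridges E \<Longrightarrow> \<exists>c :: 'v \<Rightarrow> bool. \<forall>(u, v) \<in> E. c u \<noteq> c v"
proof (induction rule: edge_induct)
  case (insert F u v)
  let ?F = "F - {(u, v), (v, u)}"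
  interpret F: sgraph V F by fact
  interpret F': sgraph V ?F by (rule F.sgraph_delete_edge)
  have "all_bridges ?F" using all_bridges_mono[OF insert(5)] by auto
  then obtain c :: "'v \<Rightarrow> bool" where c: "\<And>x y. (x, y) \<in> ?F \<Longrightarrow> c x \<noteq> c y" using insert(4) by auto
  have nb: "(u, v) \<notin> ?F\<^sup>*" using insert(3,5) unfolding all_bridges_def by auto
  \<comment> \<open>Swaps the colours on the side of \<open>u\<close> exactly when the bridge would
    join equal colours.\<close>
  define d where "d w = (if (u, w) \<in> ?F\<^sup>* then c w \<noteq> (c u = c v) else c w)" for w
  have "d x \<noteq> d y" if xy: "(x, y) \<in> F" for x y
  proof (cases "(x, y) \<in> ?F")
    case True
    then have "(u, x) \<in> ?F\<^sup>* \<longleftrightarrow> (u, y) \<in> ?F\<^sup>*"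
      using F'.E_D[of x y] by (meson rtrancl.rtrancl_into_rtrancl)
    then show ?thesis using c[OF True] unfolding d_def by auto
  next
    case False
    then have "(x, y) = (u, v) \<or> (x, y) = (v, u)" using xy by auto
    then show ?thesis using nb unfolding d_def by auto
  qed
  then show ?case by (intro exI[of _ d]) auto
qed auto

lemma comps_connected:
  assumes "V \<noteq> {}" "\<And>u v. u \<in> V \<Longrightarrow> v \<in> V \<Longrightarrow> (u, v) \<in> E\<^sup>*"
  shows "comps V E = {V}"
proof -
  have "E\<^sup>* `` {v} = V" if "v \<in> V" for v using assms(2) that rtrancl_V by auto
  then show ?thesis unfolding comps_def using assms(1) by auto
qed

text \<open>An edge that is no bridge could be deleted without disconnecting, leaving two arcs fewer
  than \<open>card_edges_ge\<close> allows for one component.\<close>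

lemma connected_all_bridgesI:
  assumes "V \<noteq> {}" "\<And>u v. u \<in> V \<Longrightarrow> v \<in> V \<Longrightarrow> (u, v) \<in> E\<^sup>*" "card E + 2 = 2 * card V"
  shows "all_bridges E"
proof (rule ccontr)
  assume "\<not> all_bridges E"
  then obtain u v where uv: "(u, v) \<in> E" "(u, v) \<in> (E - {(u, v), (v, u)})\<^sup>*"
    unfolding all_bridges_def by auto
  interpret F: sgraph V "E - {(u, v), (v, u)}" by (rule sgraph_delete_edge)
  have "card (comps V (E - {(u, v), (v, u)})) = 1"
    using comps_connected[OF assms(1,2)] comps_non_bridge[OF uv] by simp
  then show False
    using F.card_edges_ge card_delete_edge[OF uv(1)] assms(3) by simp
qed

end

section \<open>Reachability, connectedness and cycles of the digraph library in these terms\<close>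

lemma (in sgraph) rtrancl_on_iff:
  assumes "u \<in> V"
  shows "(u, v) \<in> rtrancl_on V E \<longleftrightarrow> (u, v) \<in> E\<^sup>*"
proof
  assume "(u, v) \<in> E\<^sup>*"
  then show "(u, v) \<in> rtrancl_on V E"
    by (induction rule: rtrancl_induct)
      (use assms E_V in \<open>auto intro: rtrancl_on_into_rtrancl_on\<close>)
next
  assume "(u, v) \<in> rtrancl_on V E"
  then show "(u, v) \<in> E\<^sup>*" by induction auto
qed

lemma (in pair_graph) sgraph: "sgraph (pverts G) (parcs G)"
proof
  show "finite (pverts G)" by (rule pair_finite_verts)
  show "parcs G \<subseteq> pverts G \<times> pverts G" using wellformed' by auto
  show "sym (parcs G)" using pair_sym_arcs by (simp add: symmetric_def)
  show "irrefl (parcs G)" using pair_no_loops by (force simp: irrefl_def)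
qed

lemma (in pair_graph) connected_iff:
  "Digraph_Component.connected (with_proj G) \<longleftrightarrow>
     pverts G \<noteq> {} \<and> (\<forall>u \<in> pverts G. \<forall>v \<in> pverts G. (u, v) \<in> (parcs G)\<^sup>*)"
proof -
  interpret sgraph "pverts G" "parcs G" by (rule sgraph)
  have "parcs (mk_symmetric (with_proj G)) = parcs G"
    using adj_mk_symmetric_eq[OF pair_sym_arcs] by simp
  then show ?thesis
    unfolding Digraph_Component.connected_def strongly_connected_def reachable_def
    by (simp add: rtrancl_on_iff)
qed

lemma pcas_rtrancl: "pcas u p v \<Longrightarrow> set p \<subseteq> R \<Longrightarrow> (u, v) \<in> R\<^sup>*"
proof (induction p arbitrary: u)
  case (Cons e p)
  then show ?case by (cases e) (auto intro: converse_rtrancl_into_rtrancl)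
qed auto

lemma fst_in_butlast_pawalk_verts: "e \<in> set p \<Longrightarrow> fst e \<in> set (butlast (pawalk_verts u p))"
proof (induction p arbitrary: u)
  case (Cons a p)
  have "pawalk_verts w p \<noteq> []" for w by (cases p) auto
  then show ?case using Cons by auto
qed auto

lemma last_pawalk_verts: "pcas u p v \<Longrightarrow> last (pawalk_verts u p) = v"
proof (induction p arbitrary: u)
  case (Cons a p)
  have "pawalk_verts w p \<noteq> []" for w by (cases p) auto
  then show ?case using Cons by auto
qed auto

text \<open>The detour around a non-bridge closes up to a cycle; a cycle without its first arc is a
  detour around the edge of that arc.\<close>

lemma (in pair_graph) no_undirected_cycle_iff:
  "(\<nexists>c. undirected_cycle G c) \<longleftrightarrow> all_bridges (parcs G)"
proof -
  interpret sg: sgraph "pverts G" "parcs G" by (rule sgraph)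
  have 1: "\<exists>c. undirected_cycle G c"
    if uv: "(u, v) \<in> parcs G" "(u, v) \<in> (parcs G - {(u, v), (v, u)})\<^sup>*" for u v
  proof -
    let ?F = "parcs G - {(u, v), (v, u)}"
    interpret F: sgraph "pverts G" ?F by (rule sg.sgraph_delete_edge)
    define G' where "G' = \<lparr> pverts = pverts G, parcs = ?F \<rparr>"
    interpret G': pair_wf_digraph G'
      by unfold_locales (use F.E_V in \<open>auto simp: G'_def\<close>)
    have V: "u \<in> pverts G" "v \<in> pverts G" "u \<noteq> v" using sg.E_D[OF uv(1)] by auto
    have "(v, u) \<in> ?F\<^sup>*" using F.rtrancl_sym uv by auto
    then have "(v, u) \<in> rtrancl_on (pverts G) ?F" using V F.rtrancl_on_iff by auto
    then have "reachable (with_proj G') v u" unfolding reachable_def G'_def by simp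
    then obtain p where "G'.apath v p u" using G'.reachable_apath by blast
    then have p: "set p \<subseteq> ?F" "pcas v p u" "distinct (pawalk_verts v p)"
      unfolding G'.apath_def G'.awalk_def by (auto simp: G'_def)
    have "cycle ((u, v) # p)"
      unfolding cycle_def awalk_def using p uv V by (intro exI[of _ u]) auto
    \<comment> \<open>The detour avoids the arc \<open>(v, u)\<close> and
      \<open>u \<noteq> v\<close>, so it has at least two arcs; this gives the length 3 that
      \<open>undirected_cycle\<close> demands.\<close>
    moreover have "length p \<ge> 2"
    proof (cases p)
      case Nil then show ?thesis using p V by auto
    next
      case (Cons e r)
      then show ?thesis using p by (cases r; cases e) auto
    qed
    ultimately show ?thesis unfolding undirected_cycle_def by (intro exI[of _ "(u, v) # p"]) auto
  qed
  have 2: False if ab: "all_bridges (parcs G)" and c: "undirected_cycle G c" for c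
  proof -
    from c obtain u where w: "awalk u c u" "distinct (tl (pawalk_verts u c))" "length c \<ge> 3"
      unfolding undirected_cycle_def cycle_def by auto
    obtain v p where char_poly_on: "c = (u, v) # p"
      using w unfolding awalk_def by (cases c) auto
    have p: "pcas v p u" "set p \<subseteq> parcs G" "(u, v) \<in> parcs G" "distinct (pawalk_verts v p)" "length p \<ge> 2"
      using w unfolding awalk_def char_poly_on by auto
    have ne: "pawalk_verts x r \<noteq> []" for x r by (cases r) auto
    have bl: "pawalk_verts v p = butlast (pawalk_verts v p) @ [u]"
      using last_pawalk_verts[OF p(1)] ne append_butlast_last_id by metis
    have nu: "u \<notin> set (butlast (pawalk_verts v p))" using p(4) by (subst (asm) bl) auto
    have "(u, v) \<notin> set p" using fst_in_butlast_pawalk_verts[of "(u, v)" p v] nu by auto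
    \<comment> \<open>The vertices of \<open>p\<close> are distinct, so an arc leaving
      \<open>v\<close> must be the first one; it would reach \<open>u\<close>, the last vertex, with
      arcs still to come because \<open>length p \<ge> 2\<close>.\<close>
    moreover have "(v, u) \<notin> set p"
    proof
      assume vu: "(v, u) \<in> set p"
      obtain e r where p_eq: "p = e # r" using p(5) by (cases p) auto
      have r: "r \<noteq> []" "fst e = v" "pcas (snd e) r u" "v \<notin> set (pawalk_verts (snd e) r)"
        using p(1,4,5) unfolding p_eq by auto
      have "(v, u) \<notin> set r"
        using fst_in_butlast_pawalk_verts[of "(v, u)" r "snd e"] r(4) by (auto dest: in_set_butlastD)
      then have "snd e = u" using vu p_eq by auto
      moreover obtain e' r' where "r = e' # r'" using r(1) by (cases r) auto
      ultimately have "u \<in> set (butlast (pawalk_verts v p))"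
        unfolding p_eq using r(3) ne by auto
      then show False using nu by auto
    qed
    ultimately have "(v, u) \<in> (parcs G - {(u, v), (v, u)})\<^sup>*"
      using p(1,2) by (intro pcas_rtrancl) auto
    then have "(u, v) \<in> (parcs G - {(u, v), (v, u)})\<^sup>*"
      using sgraph.rtrancl_sym[OF sg.sgraph_delete_edge] by auto
    then show False using ab p(3) unfolding all_bridges_def by auto
  qed
  show ?thesis
  proof
    assume "\<nexists>c. undirected_cycle G c"
    then show "all_bridges (parcs G)" using 1 unfolding all_bridges_def by auto
  qed (use 2 in auto)
qed

lemma is_tree_iff:
  "is_tree G \<longleftrightarrow> pair_graph G \<and> pverts G \<noteq> {} \<and>
     (\<forall>u \<in> pverts G. \<forall>v \<in> pverts G. (u, v) \<in> (parcs G)\<^sup>*) \<and> all_bridges (parcs G)"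
proof (cases "pair_graph G")
  case True
  interpret pair_graph G by (rule True)
  show ?thesis
    unfolding is_tree_def connected_iff no_undirected_cycle_iff using True by metis
next
  case False
  then show ?thesis unfolding is_tree_def by metis
qed

subsection \<open>Polynomials acting on functions\<close>


text \<open>Acting on functions instead of vectors lets one definition serve the adjacency operator
  on vertices, the matrix operator on indices and the shift on sequences.\<close>

definition pact :: "(('s \<Rightarrow> 'c) \<Rightarrow> 's \<Rightarrow> 'c) \<Rightarrow> 'c::comm_ring_1 poly \<Rightarrow> ('s \<Rightarrow> 'c) \<Rightarrow> 's \<Rightarrow> 'c" where
  "pact L p x = (\<lambda>u. \<Sum>i\<le>degree p. coeff p i * (L ^^ i) x u)"

lemma pact_eq_sum:
  assumes "degree p \<le> n"
  shows "pact L p x u = (\<Sum>i\<le>n. coeff p i * (L ^^ i) x u)"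
  unfolding pact_def using assms
  by (intro sum.mono_neutral_left) (auto simp: coeff_eq_0)

lemma pact_0 [simp]: "pact L 0 x = (\<lambda>u. 0)"
  by (simp add: pact_def)

lemma pact_add: "pact L (p + q) x u = pact L p x u + pact L q x u"
  using pact_eq_sum[of "p + q" "max (degree p) (degree q)" L x u]
    pact_eq_sum[of p "max (degree p) (degree q)" L x u]
    pact_eq_sum[of q "max (degree p) (degree q)" L x u] degree_add_le_max[of p q]
  by (simp add: algebra_simps sum.distrib)

lemma pact_smult: "pact L (Polynomial.smult c p) x u = c * pact L p x u"
  using pact_eq_sum[of "Polynomial.smult c p" "degree p" L x u] degree_smult_le[of c p]
  by (simp add: pact_def sum_distrib_left mult.assoc)

lemma pact_pCons: "pact L (pCons a p) x u = a * x u + pact L p (L x) u"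
proof -
  have "pact L (pCons a p) x u = (\<Sum>i\<le>Suc (degree p). coeff (pCons a p) i * (L ^^ i) x u)"
    by (intro pact_eq_sum) (simp add: degree_pCons_le)
  also have "\<dots> = a * x u + (\<Sum>i\<le>degree p. coeff p i * (L ^^ i) (L x) u)"
    by (subst sum.atMost_Suc_shift) (simp add: funpow_Suc_right del: funpow.simps)
  finally show ?thesis by (simp add: pact_def)
qed

lemma pact_1 [simp]: "pact L 1 x = x"
  by (simp add: pact_def)

locale linear_op =
  fixes L :: "('s \<Rightarrow> 'c::comm_ring_1) \<Rightarrow> 's \<Rightarrow> 'c"
  assumes add: "L (\<lambda>u. x u + y u) = (\<lambda>u. L x u + L y u)"
    and scale: "L (\<lambda>u. c * x u) = (\<lambda>u. c * L x u)"
begin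

lemma zero [simp]: "L (\<lambda>u. 0) = (\<lambda>u. 0)"
  using scale[of 0 "\<lambda>_. 0"] by simp

lemma diff: "L (\<lambda>u. x u - y u) = (\<lambda>u. L x u - L y u)"
  using add[of x "\<lambda>u. (- 1) * y u"] scale[of "- 1" y] by simp

lemma funpow: "linear_op (L ^^ n)"
proof (induction n)
  case (Suc n)
  interpret n: linear_op "L ^^ n" by fact
  show ?case by unfold_locales (simp_all add: n.add n.scale add scale)
qed (unfold_locales, simp_all)

lemma pact_linear: "linear_op (pact L p)"
proof -
  have "linear_op (L ^^ n)" for n by (rule funpow)
  note l = linear_op.add[OF this] linear_op.scale[OF this]
  show ?thesis
    by unfold_locales
      (simp_all add: pact_def fun_eq_iff l sum.distrib sum_distrib_left algebra_simps)
qed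

lemma pact_L: "pact L p (L x) = L (pact L p x)"
proof (induction p arbitrary: x)
  case (pCons a p)
  have "pact L (pCons a p) (L x) = (\<lambda>u. a * L x u + L (pact L p (L x)) u)"
    using pCons by (simp add: fun_eq_iff pact_pCons)
  also have "\<dots> = L (\<lambda>u. a * x u + pact L p (L x) u)" by (simp add: add scale)
  also have "(\<lambda>u. a * x u + pact L p (L x) u) = pact L (pCons a p) x"
    by (simp add: fun_eq_iff pact_pCons)
  finally show ?case .
qed simp

lemma pact_mult: "pact L (p * q) x = pact L p (pact L q x)"
proof (induction p arbitrary: x)
  case (pCons a p)
  show ?case
    by (simp add: fun_eq_iff pact_add pact_smult pact_pCons pCons pact_L)
qed simp

lemma pact_zero [simp]: "pact L p (\<lambda>u. 0) = (\<lambda>u. 0)"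
  using linear_op.zero[OF pact_linear] .

lemma pact_eigen:
  assumes "\<And>u. L x u = c * x u"
  shows "pact L p x u = poly p c * x u"
proof (induction p arbitrary: u)
  case (pCons a p)
  interpret p: linear_op "pact L p" by (rule pact_linear)
  have "L x = (\<lambda>u. c * x u)" using assms by auto
  then show ?case using pCons by (simp add: pact_pCons p.scale algebra_simps)
qed simp

end

section \<open>The shift on sequences: annihilation by a polynomial is a linear recurrence\<close>

lemma linear_op_shift: "linear_op (\<lambda>s k. s (Suc k))"
  by unfold_locales auto

lemma funpow_shift: "((\<lambda>s k. s (Suc k)) ^^ n) s k = s (k + n)"
  by (induction n arbitrary: k) auto

context linear_op begin

text \<open>Sending \<open>x\<close> to the sequence of the sums of \<open>(L ^^ k) x\<close>
  intertwines \<open>L\<close> with the shift. Annihilation of the all-one function thus becomes a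
  recurrence for walk counts, and conversely walk counts evaluate polynomials in the
  operator.\<close>

lemma sum_pact_funpow:
  fixes x :: "'s \<Rightarrow> 'c"
  shows "(\<Sum>u\<in>V. (L ^^ k) (pact L p x) u) =
    pact (\<lambda>s k. s (Suc k)) p (\<lambda>k. \<Sum>u\<in>V. (L ^^ k) x u) k"
proof (induction p arbitrary: x k)
  case 0
  interpret k: linear_op "L ^^ k" by (rule funpow)
  show ?case by simp
next
  case (pCons a p)
  interpret k: linear_op "L ^^ k" by (rule funpow)
  interpret s: linear_op "\<lambda>s k. s (Suc k) :: 'c" by (rule linear_op_shift)
  have "pact L (pCons a p) x = (\<lambda>u. a * x u + pact L p (L x) u)"
    by (simp add: fun_eq_iff pact_pCons)
  then have "(\<Sum>u\<in>V. (L ^^ k) (pact L (pCons a p) x) u) =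
      a * (\<Sum>u\<in>V. (L ^^ k) x u) + (\<Sum>u\<in>V. (L ^^ k) (pact L p (L x)) u)"
    by (simp add: k.add k.scale sum.distrib sum_distrib_left)
  also have "(\<Sum>u\<in>V. (L ^^ k) (pact L p (L x)) u) =
      pact (\<lambda>s k. s (Suc k)) p (\<lambda>k. \<Sum>u\<in>V. (L ^^ k) (L x) u) k" by (rule pCons)
  finally show ?case by (simp add: pact_pCons funpow_swap1)
qed

lemma pact_coprime:
  fixes p q :: "'c poly"
  assumes "pact L p x = (\<lambda>u. 0)" "pact L q x = (\<lambda>u. 0)" "a * p + b * q = 1"
  shows "x = (\<lambda>u. 0)"
proof
  fix u
  have "x u = pact L (a * p + b * q) x u" using assms(3) by simp
  also have "\<dots> = 0" using assms(1,2) by (simp add: pact_add pact_mult)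
  finally show "x u = 0" .
qed

end

lemma irreducible_bezout:
  fixes p q :: "rat poly"
  assumes "irreducible p" "\<not> p dvd q"
  obtains a b where "a * p + b * q = 1"
proof -
  have "coprime p q" using assms irreducible_imp_prime_elem prime_elem_imp_coprime by blast
  then have "fst (bezout_coefficients p q) * p + snd (bezout_coefficients p q) * q = 1"
    by (simp add: bezout_coefficients_fst_snd)
  then show ?thesis using that by blast
qed

lemma pact_hom:
  assumes "comm_ring_hom h" "\<And>x. (\<lambda>u. h (L x u)) = K (\<lambda>u. h (x u))"
  shows "h (pact L p x u) = pact K (map_poly h p) (\<lambda>u. h (x u)) u"
proof (induction p arbitrary: x)
  case 0
  interpret comm_ring_hom h by fact
  show ?case by simp
next
  case (pCons a p)
  interpret comm_ring_hom h by fact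
  interpret m: map_poly_comm_ring_hom h ..
  show ?case using pCons(2) assms(2) by (simp add: pact_pCons hom_distribs m.map_poly_pCons_hom)
qed

subsection \<open>Adjacency operators and the Cayley-Hamilton theorem\<close>


text \<open>The cut-off at \<open>dim_row A\<close> makes vectors of dimension n the functions that
  vanish from n on.\<close>

definition matop :: "'c::comm_ring_1 mat \<Rightarrow> (nat \<Rightarrow> 'c) \<Rightarrow> nat \<Rightarrow> 'c" where
  "matop A x i = (if i < dim_row A then \<Sum>j<dim_row A. A $$ (i, j) * x j else 0)"

lemma linear_op_matop: "linear_op (matop A)"
  by unfold_locales (auto simp: matop_def fun_eq_iff algebra_simps sum.distrib sum_distrib_left)

text \<open>The adjugate identity for tI - A, applied to \<open>x\<close>, is an identity between
  vectors of polynomials in t; its k-th coefficients, hit with the k-th power of the operator,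
  telescope.\<close>

theorem cayley_hamilton:
  fixes A :: "'c::comm_ring_1 mat"
  assumes A: "A \<in> carrier_mat n n" and x: "\<And>i. i \<ge> n \<Longrightarrow> x i = 0"
  shows "pact (matop A) (char_poly A) x = (\<lambda>i. 0)"
proof
  fix i0
  interpret linear_op "matop A" by (rule linear_op_matop)
  define M where "M = char_poly_matrix A"
  define B where "B = adj_mat M"
  \<comment> \<open>The polynomial vector adj(tI - A) x, with t the indeterminate.\<close>
  define b where "b i = (if i < n then \<Sum>k<n. B $$ (i, k) * [:x k:] else 0)" for i
  have M: "M \<in> carrier_mat n n" unfolding M_def using A by simp
  have B: "B \<in> carrier_mat n n" "M * B = char_poly A \<cdot>\<^sub>m 1\<^sub>m n"
    unfolding B_def char_poly_def M_def[symmetric] using adj_mat[OF M] by auto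
  have Mij: "M $$ (i, j) = (if i = j then [:0, 1:] else 0) - [:A $$ (i, j):]" if "i < n" "j < n" for i j
    unfolding M_def char_poly_matrix_def using A that by auto
  have key: "[:0, 1:] * b i - (\<Sum>j<n. [:A $$ (i, j):] * b j) = char_poly A * [:x i:]" if i: "i < n" for i
  proof -
    have "(\<Sum>j<n. M $$ (i, j) * b j) = (\<Sum>j<n. \<Sum>k<n. M $$ (i, j) * B $$ (j, k) * [:x k:])"
      by (simp add: b_def sum_distrib_left mult.assoc)
    also have "\<dots> = (\<Sum>k<n. (\<Sum>j<n. M $$ (i, j) * B $$ (j, k)) * [:x k:])"
      by (subst sum.swap) (simp only: sum_distrib_right)
    also have "\<dots> = (\<Sum>k<n. (M * B) $$ (i, k) * [:x k:])"
      using M B(1) i by (intro sum.cong) (auto simp: scalar_prod_def atLeast0LessThan)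
    also have "\<dots> = (\<Sum>k<n. (if k = i then char_poly A * [:x i:] else 0))"
      using i by (intro sum.cong) (auto simp: B(2))
    also have "\<dots> = char_poly A * [:x i:]" using i by simp
    finally have "(\<Sum>j<n. M $$ (i, j) * b j) = char_poly A * [:x i:]" .
    moreover have "(\<Sum>j<n. M $$ (i, j) * b j) =
        (\<Sum>j<n. (if j = i then [:0, 1:] * b i else 0) - [:A $$ (i, j):] * b j)"
      using i by (intro sum.cong) (auto simp: Mij algebra_simps)
    ultimately show ?thesis using i by (simp add: sum_subtractf)
  qed
  define c where "c k i = coeff (b i) k" for k i
  \<comment> \<open>The coefficients of t times \<open>b\<close>: shifted by one, and zero at index
    0.\<close>
  define c' where "c' k = (case k of 0 \<Rightarrow> (\<lambda>i. 0) | Suc k \<Rightarrow> c k)" for k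
  have coeffs: "(\<lambda>i. coeff (char_poly A) k * x i) = (\<lambda>i. c' k i - matop A (c k) i)" for k
  proof
    fix i
    show "coeff (char_poly A) k * x i = c' k i - matop A (c k) i"
    proof (cases "i < n")
      case True
      have "coeff (char_poly A) k * x i = coeff (char_poly A * [:x i:]) k" by simp
      also have "\<dots> = coeff ([:0, 1:] * b i) k - (\<Sum>j<n. A $$ (i, j) * coeff (b j) k)"
        by (subst key[OF True, symmetric]) (simp add: coeff_sum)
      also have "coeff ([:0, 1:] * b i) k = c' k i"
        by (simp add: c'_def c_def coeff_pCons split: nat.splits)
      finally show ?thesis using True A by (simp add: matop_def c_def)
    next
      case False
      then show ?thesis using A x by (simp add: matop_def c'_def c_def b_def split: nat.splits)
    qed
  qed
  \<comment> \<open>\<open>Suc\<close> makes the top coefficient \<open>c N\<close> vanish, so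
    nothing is left of the telescoped sum.\<close>
  define N where "N = Max (insert (degree (char_poly A)) ((\<lambda>i. Suc (degree (b i))) ` {..<n}))"
  have N: "degree (char_poly A) \<le> N" unfolding N_def by (intro Max_ge) auto
  have "c N i = 0" for i
  proof (cases "i < n")
    case True
    then have "Suc (degree (b i)) \<le> N" unfolding N_def by (intro Max_ge) auto
    then show ?thesis unfolding c_def by (intro coeff_eq_0) simp
  qed (simp add: c_def b_def)
  then have cN: "c N = (\<lambda>i. 0)" by auto
  have tel: "(\<Sum>k\<le>m. (matop A ^^ k) (\<lambda>i. c' k i - matop A (c k) i) i) = - (matop A ^^ Suc m) (c m) i" for m i
  proof (induction m)
    case (Suc m)
    interpret S: linear_op "matop A ^^ Suc m" by (rule funpow)
    have "c' (Suc m) = c m" by (simp add: c'_def)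
    moreover have "(matop A ^^ Suc m) (matop A (c (Suc m))) = (matop A ^^ Suc (Suc m)) (c (Suc m))"
      by (simp add: funpow_Suc_right del: funpow.simps)
    ultimately show ?case using Suc
      by (simp add: S.diff del: funpow.simps)
  qed (simp add: c'_def)
  have "pact (matop A) (char_poly A) x i0 = (\<Sum>k\<le>N. coeff (char_poly A) k * (matop A ^^ k) x i0)"
    by (rule pact_eq_sum[OF N])
  also have "\<dots> = (\<Sum>k\<le>N. (matop A ^^ k) (\<lambda>i. c' k i - matop A (c k) i) i0)"
    unfolding coeffs[symmetric] linear_op.scale[OF funpow] ..
  also have "\<dots> = 0"
    unfolding tel cN using linear_op.zero[OF funpow] by (simp del: funpow.simps)
  finally show "pact (matop A) (char_poly A) x i0 = 0" .
qed

section \<open>Functions on vertices, unions of components, and the matrices that represent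
  them\<close>

definition adjop :: "'v set \<Rightarrow> ('v \<times> 'v) set \<Rightarrow> ('v \<Rightarrow> 'c::comm_ring_1) \<Rightarrow> 'v \<Rightarrow> 'c" where
  "adjop V E x u = (\<Sum>v\<in>V. if (u, v) \<in> E then x v else 0)"

definition restr :: "'v set \<Rightarrow> ('v \<Rightarrow> 'c::comm_ring_1) \<Rightarrow> 'v \<Rightarrow> 'c" where
  "restr W x u = (if u \<in> W then x u else 0)"

definition mat_of :: "'v list \<Rightarrow> ('v \<times> 'v) set \<Rightarrow> 'c::comm_ring_1 mat" where
  "mat_of xs E = mat (length xs) (length xs) (\<lambda>(i, j). if (xs ! i, xs ! j) \<in> E then 1 else 0)"

definition vec_of :: "'v list \<Rightarrow> ('v \<Rightarrow> 'c) \<Rightarrow> 'c vec" where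
  "vec_of xs x = vec (length xs) (\<lambda>i. x (xs ! i))"

lemma mat_of_carrier [simp]: "mat_of xs E \<in> carrier_mat (length xs) (length xs)"
  by (simp add: mat_of_def)

lemma mat_of_dim [simp]: "dim_row (mat_of xs E) = length xs" "dim_col (mat_of xs E) = length xs"
  by (simp_all add: mat_of_def)

lemma linear_op_adjop: "linear_op (adjop V E)"
  by unfold_locales
    (auto simp: adjop_def fun_eq_iff sum_distrib_left simp flip: sum.distrib intro!: sum.cong)

lemma adjop_hom:
  assumes "comm_ring_hom h"
  shows "(\<lambda>u. h (adjop V E x u)) = adjop V E (\<lambda>u. h (x u))"
proof -
  interpret comm_ring_hom h by fact
  show ?thesis by (auto simp: adjop_def fun_eq_iff hom_sum intro!: sum.cong)
qed

lemma sum_nth: "distinct xs \<Longrightarrow> (\<Sum>j<length xs. f (xs ! j)) = (\<Sum>v\<in>set xs. f v)"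
  using sum.reindex_bij_betw[OF bij_betw_nth[of xs "{..<length xs}" "set xs"], of f] by simp

lemma vec_of_surj:
  assumes "distinct xs" "v \<in> carrier_vec (length xs)"
  obtains x where "\<And>u. u \<notin> set xs \<Longrightarrow> x u = (0 :: 'c :: zero)" "vec_of xs x = v"
proof -
  define x where "x u = (if u \<in> set xs then v $ (the_inv_into {..<length xs} ((!) xs) u) else 0)" for u
  have "inj_on ((!) xs) {..<length xs}" using assms(1) by (auto intro!: inj_onI simp: nth_eq_iff_index_eq)
  then have "the_inv_into {..<length xs} ((!) xs) (xs ! i) = i" if "i < length xs" for i
    using that by (intro the_inv_into_f_f) auto
  then have "vec_of xs x = v" using assms(2) by (intro eq_vecI) (auto simp: vec_of_def x_def)
  then show ?thesis using that[of x] by (auto simp: x_def)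
qed

text \<open>The closed sets are the unions of components. Restriction to such a set commutes with
  the adjacency operator, so induced subgraphs need no operator of their own.\<close>

locale sgraph_closed = sgraph V E for V :: "'v set" and E +
  fixes W
  assumes W_V: "W \<subseteq> V" and closed: "(u, v) \<in> E \<Longrightarrow> u \<in> W \<longleftrightarrow> v \<in> W"
begin

lemma finite_W: "finite W" using W_V finite_V finite_subset by auto

lemma adjop_W:
  assumes "u \<in> W"
  shows "adjop V E x u = (\<Sum>v\<in>W. if (u, v) \<in> E then x v else 0)"
  unfolding adjop_def using finite_V W_V closed assms
  by (intro sum.mono_neutral_right) auto

lemma adjop_restr: "adjop V E (restr W x) = restr W (adjop V E x)"
proof
  fix u
  show "adjop V E (restr W x) u = restr W (adjop V E x) u"
    unfolding adjop_def restr_def using closed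
    by (auto intro!: sum.cong sum.neutral)
qed

lemma pact_restr: "pact (adjop V E) p (restr W x) = restr W (pact (adjop V E) p x)"
proof -
  have "(adjop V E ^^ n) (restr W x) = restr W ((adjop V E ^^ n) x)" for n
    by (induction n) (simp_all add: adjop_restr)
  then show ?thesis by (auto simp: pact_def restr_def fun_eq_iff)
qed

context
  fixes xs
  assumes xs: "distinct xs" "set xs = W"
begin

lemma mat_of_mult_vec_of: "mat_of xs E *\<^sub>v vec_of xs x = vec_of xs (adjop V E x)"
proof (rule eq_vecI)
  fix i assume i: "i < dim_vec (vec_of xs (adjop V E x))"
  then have "xs ! i \<in> W" using xs by (auto simp: vec_of_def)
  then have "vec_of xs (adjop V E x) $ i =
      (\<Sum>j<length xs. if (xs ! i, xs ! j) \<in> E then x (xs ! j) else 0)"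
    using i sum_nth[OF xs(1), of "\<lambda>v. if (xs ! i, v) \<in> E then x v else 0"] xs(2)
    by (simp add: vec_of_def adjop_W)
  also have "\<dots> = (mat_of xs E *\<^sub>v vec_of xs x) $ i"
    using i by (auto simp: mat_of_def vec_of_def scalar_prod_def atLeast0LessThan intro!: sum.cong)
  finally show "(mat_of xs E *\<^sub>v vec_of xs x) $ i = vec_of xs (adjop V E x) $ i" ..
qed (simp add: vec_of_def)

lemma root_char_poly_iff:
  "poly (char_poly (mat_of xs E)) c = 0 \<longleftrightarrow>
    (\<exists>x. (\<forall>u. u \<notin> W \<longrightarrow> x u = 0) \<and> (\<exists>u. x u \<noteq> 0) \<and> (\<forall>u. adjop V E x u = c * x u))"
  (is "?L \<longleftrightarrow> ?R") for c :: "'c :: field"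
proof -
  have "?L \<longleftrightarrow> (\<exists>v. eigenvector (mat_of xs E) v c)"
    using eigenvalue_root_char_poly[OF mat_of_carrier, of xs E c] by (simp add: eigenvalue_def)
  also have "\<dots> \<longleftrightarrow> ?R"
  proof
    assume "\<exists>v. eigenvector (mat_of xs E) v c"
    then obtain v where v: "v \<in> carrier_vec (length xs)" "v \<noteq> 0\<^sub>v (length xs)"
      "mat_of xs E *\<^sub>v v = c \<cdot>\<^sub>v v" unfolding eigenvector_def by auto
    obtain x where x: "\<And>u. u \<notin> set xs \<Longrightarrow> x u = 0" "vec_of xs x = v"
      using vec_of_surj[OF xs(1) v(1)] by metis
    have "x \<noteq> (\<lambda>u. 0)" using v(2) x(2) by (auto simp: vec_of_def)
    moreover have "adjop V E x u = c * x u" for u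
    proof (cases "u \<in> W")
      case True
      then obtain i where i: "i < length xs" "u = xs ! i" using xs by (auto simp: in_set_conv_nth)
      have "vec_of xs (adjop V E x) = c \<cdot>\<^sub>v vec_of xs x"
        using v(3) mat_of_mult_vec_of[of x] x(2) by simp
      then have "vec_of xs (adjop V E x) $ i = (c \<cdot>\<^sub>v vec_of xs x) $ i" by simp
      then show ?thesis using i by (simp add: vec_of_def)
    next
      case False
      then have "x = restr W x" using x(1) xs by (auto simp: restr_def)
      then have "adjop V E x u = restr W (adjop V E x) u" using adjop_restr by metis
      then show ?thesis using False x(1) xs by (simp add: restr_def)
    qed
    ultimately show ?R using x(1) xs by (intro exI[of _ x]) (auto simp: fun_eq_iff)
  next
    assume ?R
    then obtain x u where x: "\<And>u. u \<notin> W \<Longrightarrow> x u = 0" "x u \<noteq> 0" "adjop V E x = (\<lambda>u. c * x u)"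
      by (auto simp: fun_eq_iff)
    have "u \<in> set xs" using x xs by auto
    then obtain i where i: "i < length xs" "u = xs ! i" by (auto simp: in_set_conv_nth)
    have "vec_of xs x $ i \<noteq> 0\<^sub>v (length xs) $ i" using i x(2) by (simp add: vec_of_def)
    then have "eigenvector (mat_of xs E) (vec_of xs x) c"
      unfolding eigenvector_def mat_of_mult_vec_of x(3) by (auto simp: vec_of_def)
    then show "\<exists>v. eigenvector (mat_of xs E) v c" ..
  qed
  finally show ?thesis .
qed

text \<open>Cayley-Hamilton for the matrix is pulled back along \<open>T\<close>, which reads a
  function along \<open>xs\<close> and intertwines \<open>adjop\<close> with \<open>matop\<close>;
  outside \<open>W\<close> the restricted function gives zero anyway.\<close>

lemma char_poly_annihilates:
  "pact (adjop V E) (char_poly (mat_of xs E)) (restr W x) = (\<lambda>u. 0)"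
  for x :: "'v \<Rightarrow> 'c :: comm_ring_1"
proof
  fix u
  let ?L = "adjop V E" and ?A = "mat_of xs E :: 'c mat"
  define T where "T y i = (if i < length xs then y (xs ! i) else 0)" for y :: "'v \<Rightarrow> 'c" and i
  have T: "T (?L y) = matop ?A (T y)" for y
  proof
    fix i
    have "i < length xs \<Longrightarrow> (mat_of xs E *\<^sub>v vec_of xs y) $ i = vec_of xs (adjop V E y) $ i"
      unfolding mat_of_mult_vec_of ..
    then show "T (?L y) i = matop ?A (T y) i"
      by (auto simp: T_def matop_def vec_of_def scalar_prod_def atLeast0LessThan
          mat_of_def intro!: sum.cong)
  qed
  have Tn: "T ((?L ^^ n) y) = (matop ?A ^^ n) (T y)" for n y
    by (induction n) (simp_all add: T)
  have Tp: "T (pact ?L p y) = pact (matop ?A) p (T y)" for p y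
  proof
    fix i
    have "T (pact ?L p y) i = (\<Sum>k\<le>degree p. coeff p k * T ((?L ^^ k) y) i)"
      by (simp add: T_def pact_def)
    then show "T (pact ?L p y) i = pact (matop ?A) p (T y) i" by (simp add: Tn pact_def)
  qed
  show "pact ?L (char_poly ?A) (restr W x) u = 0"
  proof (cases "u \<in> W")
    case True
    then obtain i where i: "i < length xs" "u = xs ! i" using xs by (auto simp: in_set_conv_nth)
    have "pact (matop ?A) (char_poly ?A) (T (restr W x)) = (\<lambda>i. 0)"
      by (rule cayley_hamilton[OF mat_of_carrier]) (simp add: T_def)
    then have "T (pact ?L (char_poly ?A) (restr W x)) i = 0" unfolding Tp by simp
    then show ?thesis using i by (simp add: T_def)
  next
    case False
    then show ?thesis by (simp add: pact_restr) (simp add: restr_def)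
  qed
qed

end

end

context sgraph begin

lemma adjop_self_adjoint:
  "(\<Sum>u\<in>V. adjop V E x u * y u) = (\<Sum>u\<in>V. x u * adjop V E y u)"
proof -
  have "(u, v) \<in> E \<longleftrightarrow> (v, u) \<in> E" for u v using E_D by blast
  then have "(\<Sum>u\<in>V. adjop V E x u * y u) = (\<Sum>u\<in>V. \<Sum>v\<in>V. x v * (if (v, u) \<in> E then y u else 0))"
    unfolding adjop_def by (auto simp: sum_distrib_right intro!: sum.cong)
  also have "\<dots> = (\<Sum>v\<in>V. \<Sum>u\<in>V. x v * (if (v, u) \<in> E then y u else 0))" by (rule sum.swap)
  finally show ?thesis unfolding adjop_def by (simp add: sum_distrib_left)
qed

lemma pact_self_adjoint:
  "(\<Sum>u\<in>V. pact (adjop V E) p x u * y u) = (\<Sum>u\<in>V. x u * pact (adjop V E) p y u)"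
proof (induction p arbitrary: x y)
  case (pCons a p)
  interpret linear_op "adjop V E" by (rule linear_op_adjop)
  have "(\<Sum>u\<in>V. adjop V E (pact (adjop V E) p x) u * y u) =
      (\<Sum>u\<in>V. x u * pact (adjop V E) p (adjop V E y) u)"
    unfolding adjop_self_adjoint by (rule pCons)
  then show ?case by (simp add: pact_pCons pact_L algebra_simps sum.distrib)
qed simp

end

text \<open>Renumbering permutes rows and columns of tI - A alike, so the sign of the permutation
  enters twice; the columns are handled as rows of the transpose.\<close>

lemma char_poly_mat_of_perm:
  assumes "distinct xs" "distinct ys" "set xs = set ys"
  shows "char_poly (mat_of xs E :: 'c::comm_ring_1 mat) = char_poly (mat_of ys E)"
proof -
  let ?n = "length ys" and ?C = "char_poly_matrix (mat_of ys E :: 'c mat)"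
  have "mset xs = mset ys" using assms set_eq_iff_mset_eq_distinct by blast
  then obtain p where p: "p permutes {..<?n}" "permute_list p ys = xs"
    using mset_eq_permutation by metis
  then have p': "p permutes {0..<?n}" by (simp add: atLeast0LessThan)
  have len: "length xs = ?n" using p(2) by auto
  have xs: "xs ! i = ys ! p i" "p i < ?n" if "i < ?n" for i
    using permute_list_nth[OF p(1) that] p permutes_in_image[OF p(1), of i] that by auto
  define D where "D = mat ?n ?n (\<lambda>(i, j). ?C $$ (i, p j))"
  have C: "?C \<in> carrier_mat ?n ?n" and D: "D \<in> carrier_mat ?n ?n" by (simp_all add: D_def)
  have pinj: "p i = p j \<longleftrightarrow> i = j" for i j using permutes_inj[OF p(1)] by (auto simp: inj_eq)
  have "char_poly_matrix (mat_of xs E :: 'c mat) = mat ?n ?n (\<lambda>(i, j). D $$ (p i, j))"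
    using xs len by (intro eq_matI) (auto simp: D_def char_poly_matrix_def mat_of_def pinj)
  then have "char_poly (mat_of xs E :: 'c mat) = signof p * det D"
    unfolding char_poly_def using det_permute_rows[OF D p'] by simp
  also have "det D = det (transpose_mat D)" using det_transpose[OF D] by simp
  also have "transpose_mat D = mat ?n ?n (\<lambda>(i, j). transpose_mat ?C $$ (p i, j))"
    using xs carrier_matD[OF C] by (intro eq_matI) (simp_all add: D_def)
  also have "det \<dots> = signof p * det (transpose_mat ?C)"
    using det_permute_rows[OF transpose_carrier_mat[THEN iffD2, OF C] p'] by simp
  also have "det (transpose_mat ?C) = char_poly (mat_of ys E)"
    using det_transpose[OF C] by (simp add: char_poly_def)
  finally show ?thesis by (cases "evenperm p") (simp_all add: sign_def)
qed

lemma char_poly_mat_of_append: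
  fixes xs ys :: "'v list"
  assumes "\<And>u v. u \<in> set xs \<Longrightarrow> v \<in> set ys \<Longrightarrow> (u, v) \<notin> E \<and> (v, u) \<notin> E" "set xs \<inter> set ys = {}"
  shows "char_poly (mat_of (xs @ ys) E :: 'c::idom mat) = char_poly (mat_of xs E) * char_poly (mat_of ys E)"
proof -
  let ?n = "length xs" and ?m = "length ys"
  have "char_poly_matrix (mat_of (xs @ ys) E :: 'c mat) =
    four_block_mat (char_poly_matrix (mat_of xs E)) (0\<^sub>m ?n ?m) (0\<^sub>m ?m ?n) (char_poly_matrix (mat_of ys E))"
    using assms(1)
    by (intro eq_matI) (auto simp: char_poly_matrix_def mat_of_def nth_append four_block_mat_def Let_def)
  then show ?thesis unfolding char_poly_def
    by (simp add: det_four_block_mat_upper_right_zero[of _ ?n _ ?m])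
qed

subsection \<open>Moments at infinity\<close>


lemma comm_ring_hom_fls_const: "comm_ring_hom (fls_const :: 'a::comm_ring_1 \<Rightarrow> 'a fls)"
  by unfold_locales (simp_all add: fls_plus_const flip: fls_const_mult_const)

lemma poly_at_infinity_hom: "comm_ring_hom poly_at_infinity"
proof -
  interpret c: comm_ring_hom "fls_const :: rat \<Rightarrow> rat fls" by (rule comm_ring_hom_fls_const)
  interpret map_poly_comm_ring_hom "fls_const :: rat \<Rightarrow> rat fls" ..
  show ?thesis by unfold_locales (simp_all add: poly_at_infinity_def hom_distribs)
qed

text \<open>Turns equations over the field of rational functions into recurrences for the
  coefficients at infinity.\<close>

lemma poly_at_infinity_mult_nth:
  "fls_nth (poly_at_infinity b * F) n = (\<Sum>i\<le>degree b. coeff b i * fls_nth F (n + int i))"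
proof -
  interpret c: comm_ring_hom "fls_const :: rat \<Rightarrow> rat fls" by (rule comm_ring_hom_fls_const)
  have "poly_at_infinity b = (\<Sum>i\<le>degree b. fls_const (coeff b i) * fls_X_inv ^ i)"
    by (simp add: poly_at_infinity_def poly_altdef degree_map_poly coeff_map_poly)
  then have "poly_at_infinity b * F = (\<Sum>i\<le>degree b. fls_const (coeff b i) * fls_shift (int i) F)"
    by (simp only: sum_distrib_right mult.assoc fls_X_inv_power_times_conv_shift(1))
  then show ?thesis by (simp add: fls_nth_sum)
qed

lemma poly_at_infinity_nth_pos: "n > 0 \<Longrightarrow> fls_nth (poly_at_infinity a) n = 0"
  using poly_at_infinity_mult_nth[of a 1 n] by simp

lemma poly_at_infinity_eq_0_iff [simp]: "poly_at_infinity b = 0 \<longleftrightarrow> b = 0"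
proof
  assume "poly_at_infinity b = 0"
  \<comment> \<open>Reads off the lowest power of t = 1/x, whose coefficient is the leading one of
    \<open>b\<close>.\<close>
  then have "0 = (\<Sum>i\<le>degree b. coeff b i * fls_nth 1 (- int (degree b) + int i))"
    using poly_at_infinity_mult_nth[of b 1 "- int (degree b)"] by simp
  also have "\<dots> = (\<Sum>i\<le>degree b. if i = degree b then coeff b i else 0)"
    by (intro sum.cong) auto
  finally show "b = 0" by simp
qed (simp add: poly_at_infinity_def)

lemma laurent_at_infinity_Fract:
  assumes "b \<noteq> 0"
  shows "laurent_at_infinity (Fract a b) = poly_at_infinity a / poly_at_infinity b"
proof -
  interpret comm_ring_hom poly_at_infinity by (rule poly_at_infinity_hom)
  obtain c d where cd: "quot_of_fract (Fract a b) = (c, d)" by force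
  have d: "d \<noteq> 0" using snd_quot_of_fract_nonzero[of "Fract a b"] cd by simp
  have "Fract c d = Fract a b" using Fract_quot_of_fract[of "Fract a b"] cd by simp
  then have "c * b = a * d" using assms d by (simp add: eq_fract)
  then have "poly_at_infinity c * poly_at_infinity b = poly_at_infinity a * poly_at_infinity d"
    by (metis hom_mult)
  then show ?thesis using d assms by (simp add: laurent_at_infinity_def cd divide_simps)
qed

lemma laurent_at_infinity_hom: "comm_ring_hom laurent_at_infinity"
proof
  interpret comm_ring_hom poly_at_infinity by (rule poly_at_infinity_hom)
  fix x y :: "rat poly fract"
  obtain a b c d where xy: "x = Fract a b" "b \<noteq> 0" "y = Fract c d" "d \<noteq> 0"
    by (metis Fract_cases)
  show "laurent_at_infinity (x + y) = laurent_at_infinity x + laurent_at_infinity y"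
    unfolding xy(1,3) using xy(2,4)
    by (simp add: laurent_at_infinity_Fract hom_distribs add_frac_eq mult.commute)
  show "laurent_at_infinity (x * y) = laurent_at_infinity x * laurent_at_infinity y"
    unfolding xy(1,3) using xy(2,4)
    by (simp add: laurent_at_infinity_Fract hom_distribs)
  show "laurent_at_infinity 1 = 1" "laurent_at_infinity 0 = 0"
    by (simp_all add: laurent_at_infinity_def)
qed

lemma laurent_at_infinity_to_fract: "laurent_at_infinity (to_fract p) = poly_at_infinity p"
  by (simp add: laurent_at_infinity_def poly_at_infinity_def)

lemma moment_add: "moment (x + y) k = moment x k + moment y k"
proof -
  interpret comm_ring_hom laurent_at_infinity by (rule laurent_at_infinity_hom)
  show ?thesis by (simp add: moment_def hom_add)
qed

text \<open>Multiplying the expansion by the denominator leaves the numerator, which has no positive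
  powers of t = 1/x, whereas moments sit at the indices \<open>k + 1 \<ge> 1\<close>.\<close>

lemma moment_Fract_recurrence:
  assumes "b \<noteq> 0"
  shows "pact (\<lambda>s k. s (Suc k)) b (moment (Fract a b)) = (\<lambda>k. 0)"
proof
  fix k
  let ?F = "laurent_at_infinity (Fract a b)"
  have "poly_at_infinity b * ?F = poly_at_infinity a"
    using assms by (simp add: laurent_at_infinity_Fract)
  then have "(\<Sum>i\<le>degree b. coeff b i * fls_nth ?F (int k + 1 + int i)) = 0"
    using poly_at_infinity_mult_nth[of b ?F "int k + 1"] poly_at_infinity_nth_pos[of "int k + 1" a]
    by simp
  then show "pact (\<lambda>s k. s (Suc k)) b (moment (Fract a b)) k = 0"
    by (simp add: pact_def funpow_shift moment_def algebra_simps)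
qed

text \<open>
  Both sides are the determinant of the matrix \<open>((1, -u\<^sup>T), (u, M))\<close>, eliminated in two ways.
\<close>

lemma det_add_all_ones:
  fixes M :: "'k::field mat"
  assumes M: "M \<in> carrier_mat n n" and B: "B \<in> carrier_mat n n" "M * B = 1\<^sub>m n" "B * M = 1\<^sub>m n"
  shows "det (M + mat n n (\<lambda>_. 1)) = det M * (1 + ones_vec n \<bullet> (B *\<^sub>v ones_vec n))"
proof -
  let ?u = "mat n 1 (\<lambda>_. 1) :: 'k mat" and ?v = "mat 1 n (\<lambda>_. 1) :: 'k mat"
  let ?s = "ones_vec n \<bullet> (B *\<^sub>v ones_vec n)"
  have Bu: "B * ?u \<in> carrier_mat n 1" using B by simp
  have MBu: "M * (B * ?u) = ?u"
    using M B by (subst assoc_mult_mat[symmetric, of _ n n _ n _ 1]) auto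
  have uv: "?u * ?v = mat n n (\<lambda>_. 1)"
    by (intro eq_matI) (auto simp: scalar_prod_def)
  have vBu: "?v * (B * ?u) = mat 1 1 (\<lambda>_. ?s)"
  proof (intro eq_matI)
    fix i j assume "i < dim_row (mat 1 1 (\<lambda>_. ?s))" "j < dim_col (mat 1 1 (\<lambda>_. ?s))"
    then have "i = 0" "j = 0" by auto
    moreover have "col ?u 0 = ones_vec n" "row ?v 0 = ones_vec n"
      by (auto simp: ones_vec_def)
    moreover have "col (B * ?u) 0 = B *\<^sub>v col ?u 0"
      using B by (intro col_mult2[of _ n n _ 1]) auto
    ultimately show "(?v * (B * ?u)) $$ (i, j) = mat 1 1 (\<lambda>_. ?s) $$ (i, j)"
      using B by simp
  qed (use B in auto)
  let ?K = "four_block_mat (1\<^sub>m 1) (- ?v) ?u M"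
  have 1: "?K = four_block_mat (1\<^sub>m 1) (0\<^sub>m 1 n) ?u (1\<^sub>m n) *
      four_block_mat (1\<^sub>m 1) (- ?v) (0\<^sub>m n 1) (M + mat n n (\<lambda>_. 1))"
    using M
    by (subst mult_four_block_mat[of _ 1 1 _ n _ n _ _ 1 _ n]) (auto simp: uv[symmetric] add_uminus_minus_mat comm_add_mat[of _ n n])
  have S: "1\<^sub>m 1 + mat 1 1 (\<lambda>_. ?s) + - mat 1 1 (\<lambda>_. ?s) = 1\<^sub>m 1"
    by (intro eq_matI) auto
  have 2: "?K = four_block_mat (1\<^sub>m 1 + mat 1 1 (\<lambda>_. ?s)) (- ?v) (0\<^sub>m n 1) M *
      four_block_mat (1\<^sub>m 1) (0\<^sub>m 1 n) (B * ?u) (1\<^sub>m n)"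
    using M B
    by (subst mult_four_block_mat[of _ 1 1 _ n _ n _ _ 1 _ n])
      (auto simp: MBu vBu S simp del: One_nat_def)
  have "det ?K = det (M + mat n n (\<lambda>_. 1))"
    unfolding 1 using M
    by (subst det_mult[of _ "1 + n"])
      (auto simp: det_four_block_mat_upper_right_zero[of _ 1 _ n] det_four_block_mat_lower_left_zero[of _ 1 _ n])
  moreover have "det ?K = det M * (1 + ?s)"
    unfolding 2 using M B
    by (subst det_mult[of _ "1 + n"])
      (auto simp: det_four_block_mat_upper_right_zero[of _ 1 _ n] det_four_block_mat_lower_left_zero[of _ 1 _ n] det_single)
  ultimately show ?thesis by simp
qed

subsection \<open>Walk counts and the coronal\<close>


lemma poly_at_infinity_const: "poly_at_infinity [:c:] = fls_const c"
  by (simp add: poly_at_infinity_def poly_altdef degree_map_poly coeff_map_poly)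

lemma poly_at_infinity_X: "poly_at_infinity [:0, 1:] = fls_X_inv"
  by (simp add: poly_at_infinity_def poly_altdef degree_map_poly coeff_map_poly)

text \<open>Counts the walks of \<open>k\<close> steps that end in \<open>W\<close>; for closed
  \<open>W\<close> these are the walks inside \<open>W\<close>. The values are rational because they
  are compared with \<open>moment\<close>.\<close>

definition walks :: "'v set \<Rightarrow> ('v \<times> 'v) set \<Rightarrow> 'v set \<Rightarrow> nat \<Rightarrow> rat" where
  "walks V E W k = (\<Sum>u\<in>V. (adjop V E ^^ k) (restr W (\<lambda>_. 1)) u)"

lemma vertex_list:
  assumes "finite (pverts G)"
  shows "distinct (vertex_list G)" "set (vertex_list G) = pverts G"
    "length (vertex_list G) = card (pverts G)"
proof -
  have "\<exists>xs. distinct xs \<and> set xs = pverts G" using finite_distinct_list[OF assms] by blast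
  then have "distinct (vertex_list G) \<and> set (vertex_list G) = pverts G"
    unfolding vertex_list_def by (rule someI_ex)
  then show "distinct (vertex_list G)" "set (vertex_list G) = pverts G"
    "length (vertex_list G) = card (pverts G)"
    using distinct_card[of "vertex_list G"] by auto
qed

lemma adjacency_matrix_carrier [simp]:
  "adjacency_matrix G \<in> carrier_mat (card (pverts G)) (card (pverts G))"
  by (simp add: adjacency_matrix_def Let_def)

lemma adjacency_matrix_dim [simp]:
  "dim_row (adjacency_matrix G) = card (pverts G)" "dim_col (adjacency_matrix G) = card (pverts G)"
  by (simp_all add: adjacency_matrix_def Let_def)

lemma char_poly_matrix_dim [simp]:
  "dim_row (char_poly_matrix A) = dim_row A" "dim_col (char_poly_matrix A) = dim_col A"
  by (simp_all add: char_poly_matrix_def)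

lemma adjacency_matrix_mat_of:
  assumes "finite (pverts G)"
  shows "adjacency_matrix G = mat_of (vertex_list G) (parcs G)"
  using vertex_list[OF assms] by (simp add: adjacency_matrix_def mat_of_def Let_def)

lemma char_poly_adjacency_hom:
  assumes "comm_ring_hom h"
  shows "char_poly (adjacency_matrix G) = map_poly h (char_poly (adjacency_matrix G))"
proof -
  interpret comm_ring_hom h by fact
  have "adjacency_matrix G = map_mat h (adjacency_matrix G)"
    by (rule eq_matI) (auto simp: adjacency_matrix_def Let_def)
  then show ?thesis using char_poly_hom[OF adjacency_matrix_carrier[of G]] by simp
qed

lemma comm_ring_hom_of_rat: "comm_ring_hom (of_rat :: rat \<Rightarrow> 'a::field_char_0)"
  by unfold_locales (simp_all add: of_rat_add of_rat_mult)

lemma map_poly_of_rat_inj: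
  assumes "map_poly (of_rat :: rat \<Rightarrow> 'a::field_char_0) p = map_poly of_rat q"
  shows "p = q"
proof (rule poly_eqI)
  fix i
  have "coeff (map_poly (of_rat :: rat \<Rightarrow> 'a) p) i = coeff (map_poly of_rat q) i" using assms by simp
  then show "coeff p i = coeff q i" by (simp add: coeff_map_poly)
qed

lemma char_poly_eq_prod_spectrum:
  "char_poly (adjacency_matrix G) = (\<Prod>x\<in>#adjacency_spectrum G. [:- x, 1:])"
  using complex_poly_decompose_multiset[of "char_poly (adjacency_matrix G)"]
    degree_monic_char_poly[of "adjacency_matrix G :: complex mat" "card (pverts G)"]
  by (simp add: adjacency_spectrum_def)

text \<open>The spectrum is complex while the coronal is rational: the monic complex polynomial is
  determined by its roots, and \<open>of_rat\<close> is injective on coefficients.\<close>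

lemma char_poly_eq_of_spectrum_eq:
  assumes "adjacency_spectrum G = adjacency_spectrum H"
  shows "char_poly (adjacency_matrix G :: rat mat) = char_poly (adjacency_matrix H)"
proof -
  have "char_poly (adjacency_matrix G :: complex mat) = char_poly (adjacency_matrix H)"
    by (simp add: char_poly_eq_prod_spectrum assms)
  then have "map_poly (of_rat :: rat \<Rightarrow> complex) (char_poly (adjacency_matrix G)) =
      map_poly of_rat (char_poly (adjacency_matrix H))"
    by (simp only: char_poly_adjacency_hom[OF comm_ring_hom_of_rat, symmetric])
  then show ?thesis by (rule map_poly_of_rat_inj)
qed

abbreviation coronal_matrix :: "'v pair_pre_digraph \<Rightarrow> rat poly fract mat" where
  "coronal_matrix G \<equiv> map_mat to_fract (char_poly_matrix (adjacency_matrix G))"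

lemma comm_ring_hom_to_fract: "comm_ring_hom (to_fract :: 'a::idom \<Rightarrow> 'a fract)"
  by unfold_locales simp_all

lemma det_coronal_matrix: "det (coronal_matrix G) = to_fract (char_poly (adjacency_matrix G))"
  unfolding char_poly_def by (rule comm_ring_hom.hom_det[OF comm_ring_hom_to_fract])

lemma char_poly_adjacency_nonzero [simp]: "char_poly (adjacency_matrix G :: rat mat) \<noteq> 0"
  using degree_monic_char_poly[OF adjacency_matrix_carrier[of G], where 'a = rat] by auto

lemma coronal_inverse:
  obtains B where "B \<in> carrier_mat (card (pverts G)) (card (pverts G))"
    "coronal_matrix G * B = 1\<^sub>m (card (pverts G))" "B * coronal_matrix G = 1\<^sub>m (card (pverts G))"
    "coronal G = ones_vec (card (pverts G)) \<bullet> (B *\<^sub>v ones_vec (card (pverts G)))"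
proof -
  have M: "coronal_matrix G \<in> carrier_mat (card (pverts G)) (card (pverts G))" by simp
  have "det (coronal_matrix G) \<noteq> 0" unfolding det_coronal_matrix by simp
  then have "mat_inverse (coronal_matrix G) \<noteq> None"
    using det_non_zero_imp_unit[OF M, of "()"] mat_inverse(1)[OF M, of "()"] by blast
  then obtain B where "mat_inverse (coronal_matrix G) = Some B" by auto
  then show ?thesis
    using mat_inverse(2)[OF M] that by (auto simp: coronal_def Let_def)
qed

text \<open>
  The matrix \<open>yI - (J - I - A)\<close> at \<open>y = -1 - x\<close> is \<open>-(xI - A + J)\<close>.
\<close>

lemma complement_char_poly:
  assumes "pair_graph G"
  shows "to_fract ((-1) ^ card (pverts G) * pcompose (char_poly (adjacency_matrix (complement_graph G))) [:-1, -1:])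
    = to_fract (char_poly (adjacency_matrix G)) * (1 + coronal G)"
proof -
  interpret pair_graph G by fact
  let ?n = "card (pverts G)" and ?C = "char_poly_matrix (adjacency_matrix (complement_graph G)) :: rat poly mat"
  let ?X = "char_poly_matrix (adjacency_matrix G) :: rat poly mat"
  let ?Y = "?X + mat ?n ?n (\<lambda>_. 1)"
  let ?h = "\<lambda>p :: rat poly. pcompose p [:-1, -1:]"
  have irrefl: "(v, v) \<notin> parcs G" for v using pair_no_loops by fastforce
  have h: "comm_ring_hom ?h"
    by unfold_locales (simp_all add: pcompose_add pcompose_mult pcompose_1)
  have n: "card (pverts (complement_graph G)) = ?n" by (simp add: complement_graph_def)
  have vl: "vertex_list (complement_graph G) = vertex_list G"
    by (simp add: vertex_list_def complement_graph_def)
  have "map_mat ?h ?C = (-1) \<cdot>\<^sub>m ?Y"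
  proof (rule eq_matI)
    fix i j
    assume "i < dim_row ((-1) \<cdot>\<^sub>m ?Y)" "j < dim_col ((-1) \<cdot>\<^sub>m ?Y)"
    then have ij: "i < ?n" "j < ?n" by auto
    let ?xs = "vertex_list G"
    have V: "?xs ! i \<in> pverts G" "?xs ! j \<in> pverts G" "?xs ! i = ?xs ! j \<longleftrightarrow> i = j"
      using nth_mem[of i ?xs] nth_mem[of j ?xs] ij vertex_list[OF pair_finite_verts]
        nth_eq_iff_index_eq[of ?xs i j] by simp_all
    then have "(?xs ! i, ?xs ! j) \<in> parcs (complement_graph G) \<longleftrightarrow> i \<noteq> j \<and> (?xs ! i, ?xs ! j) \<notin> parcs G"
      by (simp add: complement_graph_def)
    then have "adjacency_matrix (complement_graph G) $$ (i, j) =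
        (if i \<noteq> j \<and> (?xs ! i, ?xs ! j) \<notin> parcs G then 1 else 0 :: rat)"
      using ij n by (simp add: adjacency_matrix_def Let_def vl)
    moreover have "adjacency_matrix G $$ (i, j) = (if (?xs ! i, ?xs ! j) \<in> parcs G then 1 else 0 :: rat)"
      using ij by (simp add: adjacency_matrix_def Let_def)
    ultimately show "map_mat ?h ?C $$ (i, j) = ((-1) \<cdot>\<^sub>m ?Y) $$ (i, j)"
      using ij V irrefl n by (auto simp: char_poly_matrix_def pcompose_pCons one_pCons)
  qed (simp_all add: n)
  then have "?h (det ?C) = (-1) ^ ?n * det ?Y"
    using comm_ring_hom.hom_det[OF h, of ?C] det_smult[of "-1" ?Y] by simp
  then have "(-1) ^ ?n * ?h (det ?C) = ((-1) ^ ?n * (-1) ^ ?n) * det ?Y"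
    by (simp only: mult.assoc)
  then have "(-1) ^ ?n * ?h (det ?C) = det ?Y"
    by (simp flip: power_mult_distrib)
  then have "to_fract ((-1) ^ ?n * ?h (det ?C)) = det (map_mat to_fract ?Y)"
    by (simp only: comm_ring_hom.hom_det[OF comm_ring_hom_to_fract])
  also have "map_mat to_fract ?Y = coronal_matrix G + mat ?n ?n (\<lambda>_. 1)"
    by (intro eq_matI) auto
  also obtain B where B: "B \<in> carrier_mat ?n ?n"
    "coronal_matrix G * B = 1\<^sub>m ?n" "B * coronal_matrix G = 1\<^sub>m ?n"
    "coronal G = ones_vec ?n \<bullet> (B *\<^sub>v ones_vec ?n)"
    by (rule coronal_inverse)
  have "det (coronal_matrix G + mat ?n ?n (\<lambda>_. 1)) = det (coronal_matrix G) * (1 + coronal G)"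
    unfolding B(4) by (rule det_add_all_ones[OF _ B(1-3)]) simp
  finally show ?thesis by (simp add: char_poly_def det_coronal_matrix)
qed

text \<open>The two spectra fix everything in \<open>complement_char_poly\<close> except the
  coronal, and the nonzero characteristic polynomial cancels.\<close>

lemma generalized_cospectral_coronal:
  assumes "pair_graph G" "pair_graph H" "generalized_cospectral G H"
  shows "char_poly (adjacency_matrix G :: rat mat) = char_poly (adjacency_matrix H)"
    "card (pverts G) = card (pverts H)" "coronal G = coronal H"
proof -
  show 1: "char_poly (adjacency_matrix G :: rat mat) = char_poly (adjacency_matrix H)"
    using assms(3) by (intro char_poly_eq_of_spectrum_eq) (simp add: generalized_cospectral_def)
  show 2: "card (pverts G) = card (pverts H)"
    using degree_monic_char_poly[OF adjacency_matrix_carrier[of G], where 'a = rat]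
      degree_monic_char_poly[OF adjacency_matrix_carrier[of H], where 'a = rat] 1 by simp
  have "char_poly (adjacency_matrix (complement_graph G) :: rat mat) =
      char_poly (adjacency_matrix (complement_graph H))"
    using assms(3) by (intro char_poly_eq_of_spectrum_eq) (simp add: generalized_cospectral_def)
  then have "to_fract (char_poly (adjacency_matrix G)) * (1 + coronal G) =
      to_fract (char_poly (adjacency_matrix G)) * (1 + coronal H)"
    using complement_char_poly[OF assms(1)] complement_char_poly[OF assms(2)] 1 2 by simp
  then show "coronal G = coronal H" by simp
qed

text \<open>Instead of the inverse matrix, its product b with the all-one vector is expanded
  entrywise: x b = 1 + A b determines the coefficients one after the other.\<close>

lemma moment_coronal:
  assumes "pair_graph G"
  shows "moment (coronal G) k = walks (pverts G) (parcs G) (pverts G) k"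
proof -
  interpret pair_graph G by fact
  interpret sgraph "pverts G" "parcs G" by (rule sgraph)
  interpret sgraph_closed "pverts G" "parcs G" "pverts G"
    by unfold_locales (use E_V in auto)
  interpret h: comm_ring_hom laurent_at_infinity by (rule laurent_at_infinity_hom)
  interpret p: comm_ring_hom poly_at_infinity by (rule poly_at_infinity_hom)
  let ?n = "card (pverts G)" and ?A = "adjacency_matrix G :: rat mat" and ?xs = "vertex_list G"
  note xs = vertex_list[OF pair_finite_verts]
  obtain B where B: "B \<in> carrier_mat ?n ?n"
    "coronal_matrix G * B = 1\<^sub>m ?n"
    "coronal G = ones_vec ?n \<bullet> (B *\<^sub>v ones_vec ?n)"
    by (rule coronal_inverse) auto
  let ?b = "B *\<^sub>v ones_vec ?n"
  define y where "y i = laurent_at_infinity (?b $ i)" for i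
  have u: "(ones_vec ?n :: rat poly fract vec) \<in> carrier_vec ?n" by (simp add: ones_vec_def)
  have b: "?b \<in> carrier_vec ?n" by (rule mult_mat_vec_carrier[OF B(1) u])
  have Mb: "coronal_matrix G *\<^sub>v ?b = ones_vec ?n"
    using assoc_mult_mat_vec[OF _ B(1) u, of "coronal_matrix G" ?n] one_mult_mat_vec[OF u]
    unfolding B(2) by simp
  \<comment> \<open>Coefficients of x b = 1 + A b. Multiplication by x = 1/t reads one index further
    up, and the all-one vector contributes only at 0.\<close>
  have eq: "fls_nth (y i) (m + 1) = (if m = 0 then 1 else 0) + (\<Sum>j<?n. ?A $$ (i, j) * fls_nth (y j) m)"
    if i: "i < ?n" for i m
  proof -
    have "1 = (coronal_matrix G *\<^sub>v ?b) $ i" unfolding Mb using i by (simp add: ones_vec_def)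
    also have "\<dots> = (\<Sum>j<?n. to_fract (char_poly_matrix ?A $$ (i, j)) * ?b $ j)"
      using i carrier_vecD[OF b]
      by (simp del: dim_mult_mat_vec add: scalar_prod_def[of _ ?b] atLeast0LessThan)
    finally have "laurent_at_infinity 1 = laurent_at_infinity (\<Sum>j<?n. to_fract (char_poly_matrix ?A $$ (i, j)) * ?b $ j)"
      by (rule arg_cong)
    then have "1 = (\<Sum>j<?n. poly_at_infinity (char_poly_matrix ?A $$ (i, j)) * y j)"
      unfolding y_def by (simp only: h.hom_sum h.hom_mult h.hom_one laurent_at_infinity_to_fract)
    also have "\<dots> = (\<Sum>j<?n. (if j = i then fls_X_inv * y i else 0) - fls_const (?A $$ (i, j)) * y j)"
    proof (rule sum.cong)
      fix j assume "j \<in> {..<?n}"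
      then have "char_poly_matrix ?A $$ (i, j) = (if i = j then [:0, 1:] else 0) - [:?A $$ (i, j):]"
        unfolding char_poly_matrix_def using i by auto
      then have "poly_at_infinity (char_poly_matrix ?A $$ (i, j)) =
          poly_at_infinity (if i = j then [:0, 1:] else 0) - poly_at_infinity [:?A $$ (i, j):]"
        by (simp only: p.hom_minus)
      then show "poly_at_infinity (char_poly_matrix ?A $$ (i, j)) * y j =
          (if j = i then fls_X_inv * y i else 0) - fls_const (?A $$ (i, j)) * y j"
        by (cases "i = j") (simp_all add: poly_at_infinity_const poly_at_infinity_X left_diff_distrib)
    qed simp
    also have "\<dots> = fls_X_inv * y i - (\<Sum>j<?n. fls_const (?A $$ (i, j)) * y j)"
      using i by (simp add: sum_subtractf)
    finally have "fls_X_inv * y i = 1 + (\<Sum>j<?n. fls_const (?A $$ (i, j)) * y j)"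
      by (simp add: eq_diff_eq)
    then have "fls_nth (fls_X_inv * y i) m = fls_nth (1 + (\<Sum>j<?n. fls_const (?A $$ (i, j)) * y j)) m"
      by simp
    then show ?thesis
      by (simp add: fls_X_inv_times_conv_shift fls_nth_sum)
  qed
  \<comment> \<open>A start below all subdegrees: every coefficient at \<open>d\<close> vanishes,
    and the recursion carries the zeros up to index 0, from where it produces the walks. The
    inserted 0 makes \<open>d\<close> negative.\<close>
  define d where "d = Min (insert 0 ((\<lambda>i. fls_subdegree (y i)) ` {..<?n})) - 1"
  have d: "d < fls_subdegree (y i)" if "i < ?n" for i
  proof -
    have "Min (insert 0 ((\<lambda>i. fls_subdegree (y i)) ` {..<?n})) \<le> fls_subdegree (y i)"
      using that by (intro Min_le) auto
    then show ?thesis unfolding d_def by linarith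
  qed
  have zero: "d + int l \<le> 0 \<Longrightarrow> \<forall>i<?n. fls_nth (y i) (d + int l) = 0" for l
  proof (induction l)
    case 0
    then show ?case using d by simp
  next
    case (Suc l)
    have "fls_nth (y i) (d + int l + 1) = 0" if "i < ?n" for i
      unfolding eq[OF that] using Suc by (auto intro!: sum.neutral)
    then show ?case by (simp add: algebra_simps)
  qed
  have "Min (insert 0 ((\<lambda>i. fls_subdegree (y i)) ` {..<?n})) \<le> 0"
    by (intro Min_le) auto
  then have "d \<le> 0" unfolding d_def by linarith
  then have zero: "\<forall>i<?n. fls_nth (y i) 0 = 0" using zero[of "nat (- d)"] by simp
  have y: "\<forall>i<?n. fls_nth (y i) (int k + 1) = (adjop (pverts G) (parcs G) ^^ k) (restr (pverts G) (\<lambda>_. 1)) (?xs ! i)" for k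
  proof (induction k)
    case 0
    have "fls_nth (y i) (0 + 1) = 1" if "i < ?n" for i
      unfolding eq[OF that] using zero by simp
    moreover have "?xs ! i \<in> pverts G" if "i < ?n" for i using that xs nth_mem[of i ?xs] by simp
    ultimately show ?case by (simp add: restr_def)
  next
    case (Suc k)
    let ?z = "(adjop (pverts G) (parcs G) ^^ k) (restr (pverts G) (\<lambda>_. 1)) :: 'a \<Rightarrow> rat"
    have "fls_nth (y i) (int (Suc k) + 1) = adjop (pverts G) (parcs G) ?z (?xs ! i)" if i: "i < ?n" for i
    proof -
      have "fls_nth (y i) (int k + 1 + 1) = (\<Sum>j<?n. ?A $$ (i, j) * ?z (?xs ! j))"
        unfolding eq[OF i] using Suc by simp
      also have "\<dots> = (\<Sum>j<length ?xs. if (?xs ! i, ?xs ! j) \<in> parcs G then ?z (?xs ! j) else 0)"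
        using i xs(3) by (intro sum.cong) (auto simp: adjacency_matrix_def Let_def)
      also have "\<dots> = adjop (pverts G) (parcs G) ?z (?xs ! i)"
        using sum_nth[OF xs(1), of "\<lambda>v. if (?xs ! i, v) \<in> parcs G then ?z v else 0"] xs(2)
        by (simp add: adjop_def[of _ _ ?z])
      finally show ?thesis by (simp add: algebra_simps)
    qed
    then show ?case by simp
  qed
  have "laurent_at_infinity (coronal G) = (\<Sum>i<?n. y i)"
    unfolding B(3) y_def using B(1)
    by (simp add: scalar_prod_def h.hom_sum ones_vec_def atLeast0LessThan)
  then have "moment (coronal G) k = (\<Sum>i<length ?xs. (adjop (pverts G) (parcs G) ^^ k) (restr (pverts G) (\<lambda>_. 1)) (?xs ! i))"
    using y xs(3) by (simp add: moment_def fls_nth_sum)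
  then show ?thesis
    unfolding walks_def
    using sum_nth[OF xs(1), of "(adjop (pverts G) (parcs G) ^^ k) (restr (pverts G) (\<lambda>_. 1)) :: 'a \<Rightarrow> rat"] xs(2)
    by simp
qed

subsection \<open>Main eigenvalues\<close>


text \<open>Strip linear factors from \<open>p\<close> for as long as the rest still annihilates
  \<open>y\<close>; the first nonzero result is an eigenvector. The form \<open>pact L q y\<close>
  keeps it tied to \<open>y\<close>.\<close>

lemma ex_eigenvector_of_annihilated:
  fixes L :: "('s \<Rightarrow> complex) \<Rightarrow> 's \<Rightarrow> complex"
  assumes "linear_op L" "y \<noteq> (\<lambda>u. 0)" "p \<noteq> 0" "pact L p y = (\<lambda>u. 0)"
  shows "\<exists>q c. pact L q y \<noteq> (\<lambda>u. 0) \<and> (\<forall>u. L (pact L q y) u = c * pact L q y u)"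
  using assms(3,4)
proof (induction "degree p" arbitrary: p rule: less_induct)
  case less
  interpret linear_op L by fact
  show ?case
  proof (cases "degree p = 0")
    case True
    then obtain c where p: "p = [:c:]" by (auto elim: degree_eq_zeroE)
    have "pact L p y = (\<lambda>u. c * y u)" by (simp add: p fun_eq_iff pact_pCons)
    then show ?thesis using less assms(2) p by (auto simp: fun_eq_iff)
  next
    case False
    then obtain z where "poly p z = 0"
      using fundamental_theorem_of_algebra[of p] constant_degree by metis
    then obtain r where r: "p = [:- z, 1:] * r" by (auto simp: poly_eq_0_iff_dvd)
    have r0: "r \<noteq> 0" using less(2) r by auto
    show ?thesis
    proof (cases "pact L r y = (\<lambda>u. 0)")
      case True
      have "degree r < degree p" using degree_mult_eq[of "[:- z, 1:]" r] r0 unfolding r by (simp del: mult_pCons_left)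
      from less(1)[OF this r0 True] show ?thesis .
    next
      case False
      have "pact L [:- z, 1:] (pact L r y) = (\<lambda>u. 0)" using less(3) unfolding r pact_mult .
      then have "\<forall>u. L (pact L r y) u = z * pact L r y u"
        by (simp add: fun_eq_iff pact_pCons)
      then show ?thesis using False by blast
    qed
  qed
qed

context sgraph begin

text \<open>
  If \<open>P(A) 1\<close> were nonzero, some \<open>v = q(A) P(A) 1\<close> would be an eigenvector; self-adjointness gives
  \<open>\<langle>v, v\<rangle> = (qP)(\<lambda>) \<langle>1, v\<rangle>\<close>, so the eigenvalue \<open>\<lambda>\<close> is main but not a root of \<open>P\<close>.
\<close>

lemma main_annihilates:
  fixes P :: "complex poly"
  assumes main: "\<And>l (x :: 'v \<Rightarrow> real). (\<And>u. u \<notin> V \<Longrightarrow> x u = 0) \<Longrightarrow>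
    (\<And>u. adjop V E x u = l * x u) \<Longrightarrow> (\<Sum>u\<in>V. x u) \<noteq> 0 \<Longrightarrow> poly P (of_real l) = 0"
  shows "pact (adjop V E) P (restr V (\<lambda>_. 1)) = (\<lambda>u. 0)"
proof (rule ccontr)
  interpret sgraph_closed V E V by unfold_locales (use E_V in auto)
  let ?L = "adjop V E :: ('v \<Rightarrow> complex) \<Rightarrow> 'v \<Rightarrow> complex"
  interpret linear_op ?L by (rule linear_op_adjop)
  define y where "y = pact ?L P (restr V (\<lambda>_. 1))"
  assume "\<not> ?thesis"
  then have y0: "y \<noteq> (\<lambda>u. 0)" by (simp add: y_def)
  obtain xs where xs: "distinct xs" "set xs = V" using finite_distinct_list[OF finite_V] by blast
  let ?p = "char_poly (mat_of xs E) :: complex poly"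
  have "?p \<noteq> 0" using degree_monic_char_poly[OF mat_of_carrier[of xs E], where ?'a = complex] by auto
  \<comment> \<open>\<open>y\<close> is a polynomial in the operator applied to the all-one
    function, so \<open>?p\<close> commutes past that polynomial and annihilates \<open>y\<close>
    too.\<close>
  moreover have "pact ?L ?p y = pact ?L P (pact ?L ?p (restr V (\<lambda>_. 1)))"
    unfolding y_def pact_mult[symmetric] by (simp add: mult.commute)
  then have "pact ?L ?p y = (\<lambda>u. 0)" by (simp add: char_poly_annihilates[OF xs])
  ultimately obtain q c where q: "pact ?L q y \<noteq> (\<lambda>u. 0)" "\<And>u. ?L (pact ?L q y) u = c * pact ?L q y u"
    using ex_eigenvector_of_annihilated[OF linear_op_adjop y0] by blast
  define v where "v = pact ?L (q * P) (restr V (\<lambda>_. 1))"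
  have v: "v \<noteq> (\<lambda>u. 0)" "\<And>u. ?L v u = c * v u"
    using q unfolding v_def y_def pact_mult by auto
  have supp: "v u = 0" if "u \<notin> V" for u
    using that unfolding v_def pact_restr by (simp add: restr_def)
  have vv: "(\<Sum>u\<in>V. v u * cnj (v u)) \<noteq> 0"
  proof
    assume "(\<Sum>u\<in>V. v u * cnj (v u)) = 0"
    then have "of_real (\<Sum>u\<in>V. (cmod (v u))\<^sup>2) = (0 :: complex)"
      unfolding of_real_sum complex_norm_square .
    then have "(\<Sum>u\<in>V. (cmod (v u))\<^sup>2) = 0" by (simp only: of_real_eq_0_iff)
    then have "\<forall>u\<in>V. v u = 0" using finite_V by (simp add: sum_nonneg_eq_0_iff)
    then show False using supp v(1) by (auto simp: fun_eq_iff)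
  qed
  have cnj: "?L (\<lambda>u. cnj (v u)) u = cnj c * cnj (v u)" for u
  proof -
    have "?L (\<lambda>u. cnj (v u)) u = cnj (?L v u)"
      unfolding adjop_def by (auto intro!: sum.cong)
    then show ?thesis by (simp add: v(2))
  qed
  have "c * (\<Sum>u\<in>V. v u * cnj (v u)) = (\<Sum>u\<in>V. ?L v u * cnj (v u))"
    by (simp add: v(2) sum_distrib_left mult.assoc)
  also have "\<dots> = cnj c * (\<Sum>u\<in>V. v u * cnj (v u))"
    unfolding adjop_self_adjoint cnj by (simp add: sum_distrib_left algebra_simps)
  finally have "c = cnj c" using vv by simp
  then obtain l where c: "c = of_real l" using Reals_cnj_iff[of c] by (auto elim: Reals_cases)
  have "(\<Sum>u\<in>V. v u * cnj (v u)) = (\<Sum>u\<in>V. restr V (\<lambda>_. 1) u * pact ?L (q * P) (\<lambda>u. cnj (v u)) u)"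
    unfolding pact_self_adjoint[symmetric] v_def[symmetric] ..
  also have "\<dots> = poly (q * P) c * (\<Sum>u\<in>V. cnj (v u))"
    using pact_eigen[of "\<lambda>u. cnj (v u)" c "q * P"] cnj c
    by (simp add: restr_def sum_distrib_left)
  finally have nz: "poly P c \<noteq> 0" "(\<Sum>u\<in>V. cnj (v u)) \<noteq> 0" using vv by auto
  have "(\<Sum>u\<in>V. v u) \<noteq> 0"
    using nz(2) by (simp flip: cnj_sum)
  \<comment> \<open>Main eigenvalues are defined by real vectors: as \<open>c\<close> is real, the
    real or the imaginary part of \<open>v\<close> is an eigenvector not orthogonal to the all-one
    vector.\<close>
  then have "(\<Sum>u\<in>V. Re (v u)) \<noteq> 0 \<or> (\<Sum>u\<in>V. Im (v u)) \<noteq> 0"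
    using complex_eqI[of "\<Sum>u\<in>V. v u" 0] by auto
  moreover have "adjop V E (\<lambda>u. Re (v u)) u = l * Re (v u)" "adjop V E (\<lambda>u. Im (v u)) u = l * Im (v u)" for u
  proof -
    have "adjop V E (\<lambda>u. Re (v u)) u = Re (?L v u)" "adjop V E (\<lambda>u. Im (v u)) u = Im (?L v u)"
      unfolding adjop_def by (auto intro!: sum.cong)
    then show "adjop V E (\<lambda>u. Re (v u)) u = l * Re (v u)" "adjop V E (\<lambda>u. Im (v u)) u = l * Im (v u)"
      by (simp_all add: v(2) c)
  qed
  ultimately have "poly P (of_real l) = 0"
    using main[of "\<lambda>u. Re (v u)" l] main[of "\<lambda>u. Im (v u)" l] supp by auto
  then show False using nz(1) c by simp
qed

end

context pair_graph begin

lemma main_eigenvalueI: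
  assumes supp: "\<And>u. u \<notin> pverts G \<Longrightarrow> x u = 0"
    and eig: "\<And>u. adjop (pverts G) (parcs G) x u = l * x u"
    and ne: "(\<Sum>u\<in>pverts G. x u) \<noteq> 0"
  shows "main_eigenvalue G l"
proof -
  interpret sgraph "pverts G" "parcs G" by (rule sgraph)
  interpret sgraph_closed "pverts G" "parcs G" "pverts G" by unfold_locales (use E_V in auto)
  let ?xs = "vertex_list G"
  note xs = vertex_list[OF pair_finite_verts]
  have Lx: "adjop (pverts G) (parcs G) x = (\<lambda>u. l * x u)" using eig by auto
  have "ones_vec (card (pverts G)) \<bullet> vec_of ?xs x = (\<Sum>i<length ?xs. x (?xs ! i))"
    using xs(3) by (simp add: scalar_prod_def ones_vec_def vec_of_def atLeast0LessThan)
  also have "\<dots> = (\<Sum>u\<in>pverts G. x u)" using sum_nth[OF xs(1), of x] xs(2) by simp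
  finally have s: "ones_vec (card (pverts G)) \<bullet> vec_of ?xs x \<noteq> 0" using ne by simp
  then have "vec_of ?xs x \<noteq> 0\<^sub>v (card (pverts G))" by (auto simp: ones_vec_def)
  moreover have "adjacency_matrix G *\<^sub>v vec_of ?xs x = l \<cdot>\<^sub>v vec_of ?xs x"
    unfolding adjacency_matrix_mat_of[OF pair_finite_verts] mat_of_mult_vec_of[OF xs(1,2)] Lx
    by (auto simp: vec_of_def)
  ultimately have "eigenvector (adjacency_matrix G) (vec_of ?xs x) l"
    using xs(3) by (simp add: eigenvector_def vec_of_def)
  then show ?thesis unfolding main_eigenvalue_def using s by blast
qed

lemma main_eigenvalue_root:
  assumes "main_eigenvalue G l"
  shows "poly (char_poly (adjacency_matrix G)) l = 0"
  using assms eigenvalue_root_char_poly[OF adjacency_matrix_carrier[of G], of l]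
  unfolding main_eigenvalue_def eigenvalue_def by auto

lemma finite_main_eigenvalues: "finite {l. main_eigenvalue G l}"
proof -
  have "char_poly (adjacency_matrix G :: real mat) \<noteq> 0"
    using degree_monic_char_poly[of "adjacency_matrix G :: real mat" "card (pverts G)"] by auto
  then have "finite {l. poly (char_poly (adjacency_matrix G)) l = (0 :: real)}"
    by (rule poly_roots_finite)
  then show ?thesis by (rule rev_finite_subset) (use main_eigenvalue_root in auto)
qed

lemma poly_main_poly:
  "poly (map_poly of_real (main_poly G)) (z :: complex) = (\<Prod>l | main_eigenvalue G l. z - of_real l)"
proof -
  interpret h: comm_ring_hom "of_real :: real \<Rightarrow> complex" by unfold_locales auto
  interpret m: map_poly_comm_ring_hom "of_real :: real \<Rightarrow> complex" ..
  show ?thesis unfolding main_poly_def by (simp add: m.hom_prod poly_prod hom_distribs)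
qed

text \<open>Every main eigenvalue is a root of the main polynomial, so
  \<open>main_annihilates\<close> applies over the complex numbers; injectivity of
  \<open>of_rat\<close> brings the identity back to the rationals.\<close>

lemma main_poly_annihilates:
  assumes "main_poly G = of_int_poly P"
  shows "pact (adjop (pverts G) (parcs G)) (of_int_poly P) (restr (pverts G) (\<lambda>_. 1)) = (\<lambda>u. 0 :: rat)"
proof
  fix u
  interpret sgraph "pverts G" "parcs G" by (rule sgraph)
  let ?L = "adjop (pverts G) (parcs G)" and ?h = "of_rat :: rat \<Rightarrow> complex"
  interpret h: comm_ring_hom ?h by (rule comm_ring_hom_of_rat)
  have cast: "map_poly of_real (of_int_poly P :: real poly) = (of_int_poly P :: complex poly)"
    "map_poly ?h (of_int_poly P) = of_int_poly P"
    by (simp_all add: map_poly_map_poly o_def)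
  have "pact ?L (of_int_poly P :: complex poly) (restr (pverts G) (\<lambda>_. 1)) = (\<lambda>u. 0)"
  proof (rule main_annihilates)
    fix l and x :: "'a \<Rightarrow> real"
    assume "\<And>u. u \<notin> pverts G \<Longrightarrow> x u = 0" "\<And>u. ?L x u = l * x u" "(\<Sum>u\<in>pverts G. x u) \<noteq> 0"
    then have "main_eigenvalue G l" by (rule main_eigenvalueI)
    then show "poly (of_int_poly P) (complex_of_real l) = 0"
      using poly_main_poly[of "of_real l"] finite_main_eigenvalues
      unfolding assms cast by (auto simp: prod_zero_iff)
  qed
  moreover have "?h (pact ?L (of_int_poly P) (restr (pverts G) (\<lambda>_. 1)) u) =
      pact ?L (map_poly ?h (of_int_poly P)) (\<lambda>u. ?h (restr (pverts G) (\<lambda>_. 1) u)) u"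
    by (rule pact_hom[where L = ?L and K = ?L and h = ?h,
          OF comm_ring_hom_of_rat adjop_hom[OF comm_ring_hom_of_rat]])
  moreover have "(\<lambda>u. ?h (restr (pverts G) (\<lambda>_. 1) u)) = restr (pverts G) (\<lambda>_. 1)"
    by (auto simp: restr_def)
  ultimately show "pact ?L (of_int_poly P) (restr (pverts G) (\<lambda>_. 1)) u = (0 :: rat)"
    unfolding cast by simp
qed

text \<open>A complex root of \<open>f\<close> is a root of the main polynomial, hence a main
  eigenvalue and a root of the characteristic polynomial; a Bezout identity would evaluate to 0 = 1
  there.\<close>

lemma main_factor_dvd_char_poly:
  fixes f :: "int poly"
  assumes irr: "irreducible (of_int_poly f :: rat poly)" and dvd: "of_int_poly f dvd main_poly G"
  shows "of_int_poly f dvd (char_poly (adjacency_matrix G) :: rat poly)"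
proof (rule ccontr)
  let ?f = "of_int_poly f :: rat poly" and ?p = "char_poly (adjacency_matrix G) :: rat poly"
  let ?h = "of_rat :: rat \<Rightarrow> complex"
  interpret h: comm_ring_hom ?h by (rule comm_ring_hom_of_rat)
  interpret mh: map_poly_comm_ring_hom ?h ..
  have r: "comm_ring_hom (of_real :: real \<Rightarrow> complex)" by unfold_locales auto
  interpret r: comm_ring_hom "of_real :: real \<Rightarrow> complex" by (rule r)
  interpret mr: map_poly_comm_ring_hom "of_real :: real \<Rightarrow> complex" ..
  assume "\<not> ?thesis"
  from irreducible_bezout[OF irr this] obtain a b where ab: "a * ?f + b * ?p = 1" by blast
  have cast: "map_poly of_real (of_int_poly f :: real poly) = (of_int_poly f :: complex poly)"
    "map_poly ?h (of_int_poly f) = of_int_poly f"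
    by (simp_all add: map_poly_map_poly o_def)
  have "degree ?f \<noteq> 0"
  proof
    assume "degree ?f = 0"
    then obtain c where "?f = [:c:]" by (rule degree_eq_zeroE)
    then show False using irr by (auto simp: irreducible_def is_unit_poly_iff dvd_field_iff)
  qed
  then have "degree (of_int_poly f :: complex poly) \<noteq> 0" by (simp add: degree_map_poly)
  then obtain z where z: "poly (of_int_poly f :: complex poly) z = 0"
    using fundamental_theorem_of_algebra[of "of_int_poly f"] constant_degree by metis
  obtain k where k: "main_poly G = of_int_poly f * k" using dvd by (rule dvdE)
  have "poly (map_poly of_real (main_poly G)) z = 0"
    unfolding k mr.hom_mult cast using z by simp
  then obtain l where l: "main_eigenvalue G l" "z = of_real l"
    unfolding poly_main_poly using finite_main_eigenvalues by (auto simp: prod_zero_iff)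
  have "poly (map_poly of_real (char_poly (adjacency_matrix G))) (complex_of_real l) =
      of_real (poly (char_poly (adjacency_matrix G)) l)" by simp
  also have "\<dots> = 0" using main_eigenvalue_root[OF l(1)] by simp
  also have "map_poly of_real (char_poly (adjacency_matrix G)) = (map_poly ?h ?p)"
    by (simp only: char_poly_adjacency_hom[OF comm_ring_hom_of_rat, symmetric]
        char_poly_adjacency_hom[OF r, symmetric])
  finally have "poly (map_poly ?h ?p) z = 0" using l by simp
  moreover have "poly (map_poly ?h (a * ?f + b * ?p)) z = 1" unfolding ab by simp
  ultimately show False using z by (simp add: hom_distribs cast)
qed

text \<open>Both factors belong to the index set and contribute at least 1, so the total 2 leaves
  multiplicity 1 for each.\<close>

lemma main_factors_simple:
  fixes f g :: "int poly"
  assumes mult: "main_factor_multiplicity G = 2" and main: "main_poly G = of_int_poly (f * g)"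
    and "f \<noteq> g" "lead_coeff f = 1" "lead_coeff g = 1"
    and "irreducible (of_int_poly f :: rat poly)" "irreducible (of_int_poly g :: rat poly)"
  shows "\<not> (of_int_poly f :: rat poly)\<^sup>2 dvd char_poly (adjacency_matrix G)"
    "\<not> (of_int_poly g :: rat poly)\<^sup>2 dvd char_poly (adjacency_matrix G)"
proof -
  let ?f = "of_int_poly f :: rat poly" and ?g = "of_int_poly g :: rat poly"
  let ?p = "char_poly (adjacency_matrix G) :: rat poly"
  define I where "I = {h :: rat poly. lead_coeff h = 1 \<and> irreducible h \<and> h dvd ?p \<and> map_poly of_rat h dvd main_poly G}"
  have sum: "(\<Sum>h\<in>I. multiplicity h ?p) = 2"
    using mult unfolding main_factor_multiplicity_def Let_def I_def .
  \<comment> \<open>A sum over an infinite set would be 0, not 2.\<close>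
  then have fin: "finite I" by (metis sum.infinite zero_neq_numeral)
  have main': "main_poly G = of_int_poly f * of_int_poly g" unfolding main by (simp add: of_int_poly_hom.hom_mult)
  have dvd: "of_int_poly f dvd main_poly G" "of_int_poly g dvd main_poly G" unfolding main' by auto
  have cast: "map_poly (of_rat :: rat \<Rightarrow> real) (of_int_poly h) = of_int_poly h" for h :: "int poly"
    by (simp add: map_poly_map_poly o_def)
  have I: "?f \<in> I" "?g \<in> I"
    using assms dvd main_factor_dvd_char_poly by (simp_all add: I_def cast)
  have ne: "?f \<noteq> ?g" using \<open>f \<noteq> g\<close> by simp
  have "(\<Sum>h\<in>{?f, ?g}. multiplicity h ?p) \<le> 2"
    unfolding sum[symmetric] using fin I by (intro sum_mono2) auto
  then have le: "multiplicity ?f ?p + multiplicity ?g ?p \<le> 2" using ne by simp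
  have ge: "multiplicity h ?p \<ge> 1" if "h \<in> I" for h
    using that multiplicity_eq_zero_iff[of ?p h] by (auto simp: I_def irreducible_def Suc_le_eq not_dvd_imp_multiplicity_0)
  have "multiplicity ?f ?p < 2" "multiplicity ?g ?p < 2" using le ge[OF I(1)] ge[OF I(2)] by auto
  then show "\<not> ?f\<^sup>2 dvd ?p" "\<not> ?g\<^sup>2 dvd ?p"
    using power_dvd_iff_le_multiplicity[of ?p ?f 2] power_dvd_iff_le_multiplicity[of ?p ?g 2] I
    by (auto simp: I_def irreducible_def)
qed

end

subsection \<open>Closed vertex sets\<close>


text \<open>The choice of the enumeration is immaterial by
  \<open>char_poly_mat_of_perm\<close>.\<close>

definition char_poly_on :: "('v \<times> 'v) set \<Rightarrow> 'v set \<Rightarrow> rat poly" where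
  "char_poly_on E W = char_poly (mat_of (SOME xs. distinct xs \<and> set xs = W) E)"

lemma char_poly_on_eq:
  assumes "distinct xs" "set xs = W"
  shows "char_poly_on E W = char_poly (mat_of xs E)"
proof -
  have "distinct (SOME xs. distinct xs \<and> set xs = W) \<and> set (SOME xs. distinct xs \<and> set xs = W) = W"
    using assms by (intro someI_ex[of "\<lambda>xs. distinct xs \<and> set xs = W"]) auto
  then show ?thesis unfolding char_poly_on_def using assms by (intro char_poly_mat_of_perm) auto
qed

lemma char_poly_on_Un:
  assumes "finite W" "finite X" "W \<inter> X = {}"
    and "\<And>u v. u \<in> W \<Longrightarrow> v \<in> X \<Longrightarrow> (u, v) \<notin> E \<and> (v, u) \<notin> E"
  shows "char_poly_on E (W \<union> X) = char_poly_on E W * char_poly_on E X"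
proof -
  obtain xs ys where xs: "distinct xs" "set xs = W" and ys: "distinct ys" "set ys = X"
    using finite_distinct_list assms(1,2) by metis
  have "char_poly_on E (W \<union> X) = char_poly (mat_of (xs @ ys) E)"
    using xs ys assms(3) by (intro char_poly_on_eq) auto
  then show ?thesis
    unfolding char_poly_on_eq[OF xs] char_poly_on_eq[OF ys]
    using char_poly_mat_of_append[of xs ys E] xs ys assms(3,4) by auto
qed

context sgraph_closed begin

lemma sgraph_induced: "sgraph W (E \<inter> W \<times> W)"
  using finite_W sym_E irrefl_E by unfold_locales (auto simp: sym_def irrefl_def)

lemma rtrancl_induced:
  assumes "(u, v) \<in> E\<^sup>*" "u \<in> W"
  shows "(u, v) \<in> (E \<inter> W \<times> W)\<^sup>* \<and> v \<in> W"
  using assms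
proof (induction rule: rtrancl_induct)
  case (step y z)
  then have "(y, z) \<in> E \<inter> W \<times> W" using closed by auto
  then show ?case using step by (auto intro: rtrancl_into_rtrancl)
qed auto

lemma pact_char_poly_on: "pact (adjop V E) (char_poly_on E W) (restr W x) = (\<lambda>u. 0)"
proof -
  obtain xs where xs: "distinct xs" "set xs = W" using finite_distinct_list[OF finite_W] by blast
  show ?thesis unfolding char_poly_on_eq[OF xs] by (rule char_poly_annihilates[OF xs])
qed

lemma poly_char_poly_on_iff:
  "poly (char_poly_on E W) c = 0 \<longleftrightarrow>
    (\<exists>x. (\<forall>u. u \<notin> W \<longrightarrow> x u = 0) \<and> (\<exists>u. x u \<noteq> 0) \<and> (\<forall>u. adjop V E x u = c * x u))"
proof -
  obtain xs where xs: "distinct xs" "set xs = W" using finite_distinct_list[OF finite_W] by blast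
  show ?thesis unfolding char_poly_on_eq[OF xs] by (rule root_char_poly_iff[OF xs])
qed

text \<open>Otherwise \<open>h\<close> is coprime to the characteristic polynomial on
  \<open>W\<close>; both annihilate the restricted function, which would force it to be
  zero.\<close>

lemma irreducible_dvd_char_poly_on:
  assumes "irreducible h" "pact (adjop V E) h (restr W x) = (\<lambda>u. 0)" "restr W x \<noteq> (\<lambda>u. 0)"
  shows "h dvd char_poly_on E W"
proof (rule ccontr)
  interpret linear_op "adjop V E :: ('v \<Rightarrow> rat) \<Rightarrow> 'v \<Rightarrow> rat" by (rule linear_op_adjop)
  assume "\<not> h dvd char_poly_on E W"
  from irreducible_bezout[OF assms(1) this] obtain a b where "a * h + b * char_poly_on E W = 1" by blast
  from pact_coprime[OF assms(2) pact_char_poly_on this] show False using assms(3) by simp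
qed

text \<open>Changing the sign of an eigenvector on one colour class negates the eigenvalue.\<close>

lemma two_colouring_symmetric_spectrum:
  fixes col :: "'v \<Rightarrow> bool"
  assumes col: "\<And>u v. (u, v) \<in> E \<inter> W \<times> W \<Longrightarrow> col u \<noteq> col v" and "poly (char_poly_on E W) c = 0"
  shows "poly (char_poly_on E W) (- c) = 0"
proof -
  obtain x u where x: "\<And>u. u \<notin> W \<Longrightarrow> x u = 0" "x u \<noteq> 0" "\<And>u. adjop V E x u = c * x u"
    using assms(2) unfolding poly_char_poly_on_iff by auto
  define y where "y u = (if col u then x u else - x u)" for u
  have "adjop V E y w = - c * y w" for w
  proof -
    have "adjop V E y w = (if col w then - 1 else 1) * adjop V E x w"
      unfolding adjop_def sum_distrib_left
    proof (rule sum.cong)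
      fix v
      show "(if (w, v) \<in> E then y v else 0) = (if col w then - 1 else 1) * (if (w, v) \<in> E then x v else 0)"
      proof (cases "(w, v) \<in> E")
        case E: True
        show ?thesis
        proof (cases "v \<in> W")
          case True
          then have "col w \<longleftrightarrow> \<not> col v" using col[of w v] E closed[OF E] by blast
          then show ?thesis using E by (simp add: y_def)
        next
          case False
          then show ?thesis using x(1)[of v] by (simp add: y_def)
        qed
      qed simp
    qed simp
    then show ?thesis unfolding x(3) by (simp add: y_def)
  qed
  then show ?thesis unfolding poly_char_poly_on_iff using x(1,2)
    by (intro exI[of _ y]) (auto simp: y_def intro!: exI[of _ u])
qed

lemma walks_nat: "walks V E W k \<in> \<nat>"
proof -
  have sum: "(\<And>a. a \<in> A \<Longrightarrow> f a \<in> \<nat>) \<Longrightarrow> (\<Sum>a\<in>A. f a) \<in> (\<nat> :: rat set)"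
    for f and A :: "'v set"
    by (induction A rule: infinite_finite_induct) auto
  have "(adjop V E ^^ k) (restr W (\<lambda>_. 1)) u \<in> (\<nat> :: rat set)" for u
  proof (induction k arbitrary: u)
    case (Suc k)
    then show ?case by (auto simp: adjop_def intro!: sum)
  qed (simp add: restr_def)
  then show ?thesis unfolding walks_def by (intro sum) auto
qed

section \<open>Walk counts of length at most 2 as degree sums\<close>

abbreviation (in sgraph) deg :: "'v \<Rightarrow> nat" where
  "deg u \<equiv> card {v \<in> V. (u, v) \<in> E}"

lemma adjop_one: "adjop V E (restr V (\<lambda>_. 1)) u = (of_nat (deg u) :: rat)"
  using finite_V by (simp add: adjop_def restr_def sum.If_cases Int_def cong: sum.cong if_cong)

lemma restr_W: "restr W (\<lambda>_. 1) = restr W (restr V (\<lambda>_. 1))"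
  using W_V by (auto simp: restr_def fun_eq_iff)

lemma adjop_W_one: "adjop V E (restr W (\<lambda>_. 1)) u = (if u \<in> W then of_nat (deg u) else 0 :: rat)"
  by (simp only: restr_W adjop_restr) (simp add: restr_def[of W] adjop_one)

lemma sum_W: "(\<Sum>u\<in>V. if u \<in> W then f u else 0) = (\<Sum>u\<in>W. f u)"
  using finite_V W_V by (simp add: sum.If_cases Int_absorb1)

lemma walks_0: "walks V E W 0 = of_nat (card W)"
  by (simp add: walks_def restr_def sum_W)

lemma card_induced: "card (E \<inter> W \<times> W) = (\<Sum>u\<in>W. deg u)"
proof -
  have "E \<inter> W \<times> W = (SIGMA u:W. {v \<in> V. (u, v) \<in> E})" using closed W_V by auto
  then show ?thesis using finite_W finite_V by (simp add: card_SigmaI)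
qed

lemma walks_1: "walks V E W 1 = of_nat (card (E \<inter> W \<times> W))"
  by (simp add: walks_def adjop_W_one sum_W card_induced)

text \<open>Self-adjointness moves one of the two steps to the other side, leaving the inner product
  of the degree vector with its restriction to \<open>W\<close>.\<close>

lemma walks_2: "walks V E W 2 = of_nat (\<Sum>u\<in>W. (deg u)\<^sup>2)"
proof -
  let ?r = "restr W (\<lambda>_. 1) :: 'v \<Rightarrow> rat" and ?s = "restr V (\<lambda>_. 1) :: 'v \<Rightarrow> rat"
  have "walks V E W 2 = (\<Sum>u\<in>V. adjop V E (adjop V E ?r) u * ?s u)"
    by (simp add: walks_def numeral_2_eq_2 restr_def[of V])
  also have "\<dots> = (\<Sum>u\<in>V. adjop V E ?r u * adjop V E ?s u)" by (rule adjop_self_adjoint)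
  also have "\<dots> = (\<Sum>u\<in>V. if u \<in> W then of_nat (deg u) * of_nat (deg u) else 0)"
    by (simp add: adjop_one adjop_W_one if_distrib cong: if_cong) (auto intro!: sum.cong)
  finally show ?thesis by (simp add: sum_W power2_eq_square)
qed

text \<open>A square has the parity of its base, and the degree sum is the number of arcs.\<close>

lemma even_walks_2:
  assumes "even (card (E \<inter> W \<times> W))"
  shows "even_rat (walks V E W 2)"
proof -
  have "even (\<Sum>u\<in>W. (deg u)\<^sup>2) \<longleftrightarrow> even (\<Sum>u\<in>W. deg u)"
    using finite_W by (induction W rule: finite_induct) auto
  then have "even (int (\<Sum>u\<in>W. (deg u)\<^sup>2))" using assms by (simp only: even_of_nat card_induced)
  then show ?thesis unfolding even_rat_def walks_2
    by (intro exI[of _ "int (\<Sum>u\<in>W. (deg u)\<^sup>2)"]) simp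
qed

text \<open>Sums the bound over all degrees. It is applied with (d - 1)(d - 2) >= 0 and with (d -
  2)^2 >= 0, which produce the constants in (iii).\<close>

lemma walks_2_ge:
  fixes a b :: int
  assumes "\<And>d :: int. 0 \<le> d \<Longrightarrow> d\<^sup>2 \<ge> a * d - b"
  shows "walks V E W 2 \<ge> of_int a * of_nat (card (E \<inter> W \<times> W)) - of_int b * of_nat (card W)"
proof -
  have "a * int (card (E \<inter> W \<times> W)) - b * int (card W) = (\<Sum>u\<in>W. a * int (deg u) - b)"
    by (simp add: card_induced sum_subtractf sum_distrib_left mult.commute)
  also have "\<dots> \<le> (\<Sum>u\<in>W. (int (deg u))\<^sup>2)" by (intro sum_mono assms) simp
  finally have "of_int (a * int (card (E \<inter> W \<times> W)) - b * int (card W)) \<le> (of_int (\<Sum>u\<in>W. (int (deg u))\<^sup>2) :: rat)"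
    by (simp only: of_int_le_iff)
  then show ?thesis unfolding walks_2 by simp
qed

lemma walks_recurrence:
  assumes "pact (adjop V E) p (restr W (\<lambda>_. 1)) = (\<lambda>u. 0)"
  shows "pact (\<lambda>s k. s (Suc k)) p (walks V E W) = (\<lambda>k. 0)"
proof
  fix k
  interpret linear_op "adjop V E :: ('v \<Rightarrow> rat) \<Rightarrow> 'v \<Rightarrow> rat" by (rule linear_op_adjop)
  have "pact (\<lambda>s k. s (Suc k)) p (walks V E W) k =
      (\<Sum>u\<in>V. (adjop V E ^^ k) (pact (adjop V E) p (restr W (\<lambda>_. 1))) u)"
    unfolding sum_pact_funpow walks_def[abs_def] ..
  then show "pact (\<lambda>s k. s (Suc k)) p (walks V E W) k = 0"
    using assms linear_op.zero[OF funpow] by simp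
qed

lemma connected_card_edges:
  assumes "W \<noteq> {}" "\<And>u v. u \<in> W \<Longrightarrow> v \<in> W \<Longrightarrow> (u, v) \<in> E\<^sup>*"
  shows "2 * card W \<le> card (E \<inter> W \<times> W) + 2"
    "card (E \<inter> W \<times> W) + 2 = 2 * card W \<Longrightarrow> all_bridges (E \<inter> W \<times> W)"
proof -
  interpret W: sgraph W "E \<inter> W \<times> W" by (rule sgraph_induced)
  have conn: "(u, v) \<in> (E \<inter> W \<times> W)\<^sup>*" if "u \<in> W" "v \<in> W" for u v
    using rtrancl_induced assms(2) that by blast
  show "2 * card W \<le> card (E \<inter> W \<times> W) + 2"
    using W.card_edges_ge W.comps_connected[OF assms(1) conn] by simp
  show "all_bridges (E \<inter> W \<times> W)" if "card (E \<inter> W \<times> W) + 2 = 2 * card W"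
    using W.connected_all_bridgesI[OF assms(1) conn that] .
qed

text \<open>
  An eigenvector for \<open>-2\<close> of a connected 2-regular graph alternates in sign along edges, so it
  takes two opposite values, and equally often because it is orthogonal to the all-one vector.
\<close>

lemma two_regular_even:
  assumes conn: "\<And>u v. u \<in> W \<Longrightarrow> v \<in> W \<Longrightarrow> (u, v) \<in> E\<^sup>*"
    and reg: "\<And>u. u \<in> W \<Longrightarrow> deg u = 2" and root: "poly (char_poly_on E W) (- 2) = 0"
  shows "even (card W)"
proof -
  obtain x :: "'v \<Rightarrow> rat" where x': "\<forall>u. u \<notin> W \<longrightarrow> x u = 0" "\<exists>u. x u \<noteq> 0" "\<forall>u. adjop V E x u = - 2 * x u"
    using root unfolding poly_char_poly_on_iff by blast
  then obtain u0 where x: "\<And>u. u \<notin> W \<Longrightarrow> x u = 0" "x u0 \<noteq> 0" "\<And>u. adjop V E x u = - 2 * x u"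
    by blast
  have u0: "u0 \<in> W" using x(1,2) by auto
  have swap: "(\<Sum>u\<in>V. \<Sum>v\<in>V. if (u, v) \<in> E then f v else 0) = (\<Sum>u\<in>V. \<Sum>v\<in>V. if (u, v) \<in> E then f u else 0)"
    for f :: "'v \<Rightarrow> rat"
  proof -
    have "(u, v) \<in> E \<longleftrightarrow> (v, u) \<in> E" for u v using E_D by blast
    then show ?thesis by (subst sum.swap) (auto intro!: sum.cong)
  qed
  have one: "(\<Sum>v\<in>V. if (u, v) \<in> E then f u else 0) = f u * of_nat (deg u)" for u and f :: "'v \<Rightarrow> rat"
    using finite_V by (simp add: sum.If_cases Int_def)
  have sq: "(\<Sum>u\<in>V. (x u)\<^sup>2 * of_nat (deg u)) = (\<Sum>u\<in>V. 2 * (x u)\<^sup>2)"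
  proof (rule sum.cong)
    fix u
    show "(x u)\<^sup>2 * of_nat (deg u) = 2 * (x u)\<^sup>2"
      using reg[of u] x(1)[of u] by (cases "u \<in> W") simp_all
  qed simp
  \<comment> \<open>Twice the quadratic form of 2I + A at \<open>x\<close>, which vanishes for the
    eigenvalue -2; all squares being zero, \<open>x\<close> changes sign along every edge.\<close>
  have "(\<Sum>u\<in>V. \<Sum>v\<in>V. if (u, v) \<in> E then (x u + x v)\<^sup>2 else 0) =
      (\<Sum>u\<in>V. \<Sum>v\<in>V. (if (u, v) \<in> E then (x u)\<^sup>2 else 0) + 2 * x u * (if (u, v) \<in> E then x v else 0)
        + (if (u, v) \<in> E then (x v)\<^sup>2 else 0))"
    by (intro sum.cong) (auto simp: power2_eq_square algebra_simps)
  also have "\<dots> = (\<Sum>u\<in>V. \<Sum>v\<in>V. if (u, v) \<in> E then (x u)\<^sup>2 else 0) + (\<Sum>u\<in>V. 2 * x u * adjop V E x u)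
      + (\<Sum>u\<in>V. \<Sum>v\<in>V. if (u, v) \<in> E then (x v)\<^sup>2 else 0)"
    unfolding adjop_def by (simp add: sum.distrib sum_distrib_left)
  also have "\<dots> = (\<Sum>u\<in>V. 2 * (x u)\<^sup>2) + (\<Sum>u\<in>V. 2 * x u * adjop V E x u) + (\<Sum>u\<in>V. 2 * (x u)\<^sup>2)"
    unfolding swap[of "\<lambda>v. (x v)\<^sup>2"] one[of _ "\<lambda>u. (x u)\<^sup>2"] sq ..
  also have "\<dots> = 0"
    unfolding x(3) by (simp add: power2_eq_square flip: sum.distrib)
  finally have S0: "(\<Sum>u\<in>V. \<Sum>v\<in>V. if (u, v) \<in> E then (x u + x v)\<^sup>2 else 0) = 0" .
  have nn: "(\<Sum>v\<in>V. if (u, v) \<in> E then (x u + x v)\<^sup>2 else 0) \<ge> 0" for u by (intro sum_nonneg) auto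
  have edge: "x v = - x u" if uv: "(u, v) \<in> E" for u v
  proof -
    have "(\<Sum>v\<in>V. if (u, v) \<in> E then (x u + x v)\<^sup>2 else 0) = 0"
      using S0 nn finite_V E_D[OF uv] by (simp add: sum_nonneg_eq_0_iff)
    then have "(if (u, v) \<in> E then (x u + x v)\<^sup>2 else 0) = 0"
      using finite_V E_D[OF uv] by (subst (asm) sum_nonneg_eq_0_iff) auto
    then show ?thesis using uv by (simp add: add_eq_0_iff2)
  qed
  have vals: "x u = x u0 \<or> x u = - x u0" if "u \<in> W" for u
  proof -
    have "(u0, u) \<in> E\<^sup>*" using conn u0 that by blast
    then show ?thesis by (induction rule: rtrancl_induct) (auto dest: edge)
  qed
  let ?s = "restr V (\<lambda>_. 1) :: 'v \<Rightarrow> rat"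
  \<comment> \<open>With s the sum of \<open>x\<close>, the sum of A x is both -2 s and 2 s.\<close>
  have "(\<Sum>u\<in>V. adjop V E x u * ?s u) = (\<Sum>u\<in>V. x u * adjop V E ?s u)" by (rule adjop_self_adjoint)
  also have "\<dots> = (\<Sum>u\<in>V. 2 * x u)"
  proof (rule sum.cong)
    fix u
    show "x u * adjop V E ?s u = 2 * x u"
      unfolding adjop_one using reg[of u] x(1)[of u] by (cases "u \<in> W") simp_all
  qed simp
  also have "(\<Sum>u\<in>V. adjop V E x u * ?s u) = - (\<Sum>u\<in>V. 2 * x u)"
    unfolding x(3) by (simp add: restr_def sum_negf)
  finally have "(\<Sum>u\<in>V. x u) = 0" by (simp add: sum_distrib_left[symmetric])
  moreover have "(\<Sum>u\<in>V. x u) = (\<Sum>u\<in>V. if u \<in> W then x u else 0)" using x(1) by (intro sum.cong) auto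
  ultimately have sum0: "(\<Sum>u\<in>W. x u) = 0" unfolding sum_W by simp
  define P where "P = {u \<in> W. x u = x u0}"
  define N where "N = {u \<in> W. x u = - x u0}"
  have PN: "W = P \<union> N" "P \<inter> N = {}" "finite P" "finite N"
    using vals x(2) finite_W unfolding P_def N_def by auto
  have "(\<Sum>u\<in>P. x u) = of_nat (card P) * x u0" "(\<Sum>u\<in>N. x u) = - (of_nat (card N) * x u0)"
    by (simp_all add: P_def N_def)
  then have "of_nat (card P) * x u0 = of_nat (card N) * x u0"
    using sum0 sum.union_disjoint[OF PN(3,4,2), of x] PN(1) by simp
  then have "card P = card N" using x(2) by simp
  then show ?thesis using card_Un_disjoint[OF PN(3,4,2)] PN(1) by simp
qed

end

subsection \<open>Two main factors\<close>


lemma (in sgraph) sgraph_closed_V: "sgraph_closed V E V"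
  by unfold_locales (use E_V in auto)

lemma (in sgraph) sgraph_closed_Diff:
  assumes "sgraph_closed V E W" "sgraph_closed V E X"
  shows "sgraph_closed V E (W - X)"
proof -
  interpret W: sgraph_closed V E W by fact
  interpret X: sgraph_closed V E X by fact
  show ?thesis by unfold_locales (use W.W_V W.closed X.closed in auto)
qed

lemma (in sgraph) sgraph_closed_component:
  assumes "u \<in> V"
  shows "sgraph_closed V E (E\<^sup>* `` {u})"
proof
  show "E\<^sup>* `` {u} \<subseteq> V" using rtrancl_V assms by auto
  show "x \<in> E\<^sup>* `` {u} \<longleftrightarrow> y \<in> E\<^sup>* `` {u}" if "(x, y) \<in> E" for x y
    using that E_D[OF that] by (auto intro: rtrancl_into_rtrancl)
qed

lemma (in sgraph) char_poly_on_closed_Un: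
  assumes "sgraph_closed V E W" "sgraph_closed V E X" "W \<inter> X = {}"
  shows "char_poly_on E (W \<union> X) = char_poly_on E W * char_poly_on E X"
proof -
  interpret W: sgraph_closed V E W by fact
  interpret X: sgraph_closed V E X by fact
  show ?thesis using W.finite_W X.finite_W W.closed assms(3) by (intro char_poly_on_Un) auto
qed

lemma (in sgraph) char_poly_on_closed_dvd:
  assumes "sgraph_closed V E W" "sgraph_closed V E X" "W \<subseteq> X"
  shows "char_poly_on E W dvd char_poly_on E X"
  using char_poly_on_closed_Un[OF assms(1) sgraph_closed_Diff[OF assms(2,1)]] assms(3)
  by (simp add: Un_absorb1 Diff_partition)

text \<open>What survives the passage from \<open>T\<close> to \<open>H\<close>. The roles of
  \<open>F\<close> and \<open>G\<close> are exchanged by \<open>flip\<close>.\<close>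

locale two_main_factors = sgraph V E for V :: "'v set" and E +
  fixes F G :: "rat poly"
  assumes irreducible: "irreducible F" "irreducible G"
    and annihilates: "pact (adjop V E) (F * G) (restr V (\<lambda>_. 1)) = (\<lambda>u. 0)"
    and simple: "\<not> F\<^sup>2 dvd char_poly_on E V" "\<not> G\<^sup>2 dvd char_poly_on E V"
begin

lemma flip: "two_main_factors V E G F"
  by unfold_locales (use irreducible annihilates simple in \<open>simp_all add: mult.commute\<close>)

text \<open>Either \<open>F\<close> annihilates the indicator of \<open>W\<close>, or applying
  \<open>F\<close> to it gives a nonzero function annihilated by \<open>G\<close>;
  \<open>irreducible_dvd_char_poly_on\<close> then yields the corresponding factor.\<close>

lemma factor_dvd_char_poly_on:
  assumes "sgraph_closed V E W" "W \<noteq> {}"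
  shows "F dvd char_poly_on E W \<or> G dvd char_poly_on E W"
    "\<not> G dvd char_poly_on E W \<Longrightarrow> pact (adjop V E) F (restr W (\<lambda>_. 1)) = (\<lambda>u. 0)"
proof -
  interpret W: sgraph_closed V E W by fact
  interpret linear_op "adjop V E :: ('v \<Rightarrow> rat) \<Rightarrow> 'v \<Rightarrow> rat" by (rule linear_op_adjop)
  let ?r = "restr W (\<lambda>_. 1) :: 'v \<Rightarrow> rat"
  \<comment> \<open>Formed from the constant function, so that \<open>pact (adjop V E) F ?r\<close>
    is literally a restriction, as \<open>irreducible_dvd_char_poly_on\<close> expects.\<close>
  let ?y = "pact (adjop V E) F (\<lambda>_. 1)"
  have Fr: "pact (adjop V E) F ?r = restr W ?y" by (rule W.pact_restr)
  have "pact (adjop V E) (F * G) ?r = restr W (\<lambda>u. 0)"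
    unfolding W.restr_W W.pact_restr annihilates ..
  then have "pact (adjop V E) (G * F) ?r = (\<lambda>u. 0)"
    by (simp add: restr_def[abs_def] mult.commute[of F] cong: if_cong)
  then have GF: "pact (adjop V E) G (restr W ?y) = (\<lambda>u. 0)" unfolding pact_mult Fr .
  have r0: "?r \<noteq> (\<lambda>u. 0)" using assms(2) by (auto simp: restr_def fun_eq_iff)
  show "F dvd char_poly_on E W \<or> G dvd char_poly_on E W"
    using W.irreducible_dvd_char_poly_on[OF irreducible(1) _ r0] W.irreducible_dvd_char_poly_on[OF irreducible(2) GF]
    unfolding Fr by blast
  show "pact (adjop V E) F ?r = (\<lambda>u. 0)" if "\<not> G dvd char_poly_on E W"
    using W.irreducible_dvd_char_poly_on[OF irreducible(2) GF] that unfolding Fr by blast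
qed

lemma not_both_dvd:
  assumes "sgraph_closed V E W" "sgraph_closed V E X" "W \<inter> X = {}" "F dvd char_poly_on E W" "F dvd char_poly_on E X"
  shows False
proof -
  interpret W: sgraph_closed V E W by fact
  interpret X: sgraph_closed V E X by fact
  have "sgraph_closed V E (W \<union> X)"
    by unfold_locales (use W.W_V X.W_V W.closed X.closed in auto)
  then have "char_poly_on E (W \<union> X) dvd char_poly_on E V"
    using sgraph_closed_V W.W_V X.W_V by (intro char_poly_on_closed_dvd) auto
  moreover have "F\<^sup>2 dvd char_poly_on E (W \<union> X)"
    unfolding char_poly_on_closed_Un[OF assms(1-3)] power2_eq_square using assms(4,5) by (rule mult_dvd_mono)
  ultimately show False using simple(1) dvd_trans by blast
qed

text \<open>\<open>X\<close> uses up the simple factor \<open>G\<close>, so every nonempty closed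
  part of \<open>W\<close> carries \<open>F\<close>. Splitting off a component of \<open>W\<close>
  would give \<open>F\<close> twice, hence \<open>W\<close> is connected.\<close>

lemma other_part:
  assumes W: "sgraph_closed V E W" "W \<noteq> {}" and X: "sgraph_closed V E X"
    and "W \<inter> X = {}" "G dvd char_poly_on E X"
  shows "F dvd char_poly_on E W" "\<not> G dvd char_poly_on E W"
    "pact (adjop V E) F (restr W (\<lambda>_. 1)) = (\<lambda>u. 0)"
    "\<And>u v. u \<in> W \<Longrightarrow> v \<in> W \<Longrightarrow> (u, v) \<in> E\<^sup>*"
proof -
  interpret W: sgraph_closed V E W by fact
  show nG: "\<not> G dvd char_poly_on E W" using two_main_factors.not_both_dvd[OF flip W(1) X assms(4) _ assms(5)] by blast
  show "F dvd char_poly_on E W" "pact (adjop V E) F (restr W (\<lambda>_. 1)) = (\<lambda>u. 0)"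
    using factor_dvd_char_poly_on[OF W] nG by auto
  have part: "F dvd char_poly_on E Y" if "sgraph_closed V E Y" "Y \<noteq> {}" "Y \<subseteq> W" for Y
    using factor_dvd_char_poly_on(1)[OF that(1,2)] nG char_poly_on_closed_dvd[OF that(1) W(1) that(3)] dvd_trans by blast
  fix u v
  assume uv: "u \<in> W" "v \<in> W"
  show "(u, v) \<in> E\<^sup>*"
  proof (rule ccontr)
    assume no: "(u, v) \<notin> E\<^sup>*"
    let ?C = "E\<^sup>* `` {u}"
    have C: "sgraph_closed V E ?C" using W.W_V uv by (intro sgraph_closed_component) auto
    have "?C \<subseteq> W" using W.rtrancl_induced uv by blast
    then have "F dvd char_poly_on E ?C" using part[OF C] by auto
    moreover have "F dvd char_poly_on E (W - ?C)"
      using part[OF sgraph_closed_Diff[OF W(1) C]] no uv by auto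
    ultimately show False
      using not_both_dvd[OF C sgraph_closed_Diff[OF W(1) C]] by auto
  qed
qed

end

section \<open>Conditions (i) to (iv) for a tree component and a unicyclic component\<close>

context sgraph begin

lemma moment_conditionsI:
  fixes p q :: "int poly"
  assumes W: "sgraph_closed V E W" "W \<noteq> {}" "\<And>u v. u \<in> W \<Longrightarrow> v \<in> W \<Longrightarrow> (u, v) \<in> E\<^sup>*"
    and X: "sgraph_closed V E X" "X \<noteq> {}" "\<And>u v. u \<in> X \<Longrightarrow> v \<in> X \<Longrightarrow> (u, v) \<in> E\<^sup>*"
    and V: "W \<inter> X = {}" "W \<union> X = V"
    and q: "irreducible (of_int_poly q :: rat poly)" "\<not> of_int_poly q dvd char_poly_on E W"
    and pW: "pact (adjop V E) (of_int_poly p) (restr W (\<lambda>_. 1)) = (\<lambda>u. 0 :: rat)"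
    and qX: "pact (adjop V E) (of_int_poly q) (restr X (\<lambda>_. 1)) = (\<lambda>u. 0 :: rat)"
    and EW: "card (E \<inter> W \<times> W) + 2 = 2 * card W" and EX: "card (E \<inter> X \<times> X) = 2 * card X"
    and sym: "poly (char_poly_on E V) 2 = 0 \<Longrightarrow> poly (char_poly_on E V) (- 2) = 0"
  shows "moment_conditions p (walks V E W) q (walks V E X)"
proof -
  interpret W: sgraph_closed V E W by (rule W(1))
  interpret X: sgraph_closed V E X by (rule X(1))
  interpret linear_op "adjop V E :: ('v \<Rightarrow> rat) \<Rightarrow> 'v \<Rightarrow> rat" by (rule linear_op_adjop)
  have cpV: "char_poly_on E V = char_poly_on E W * char_poly_on E X" using char_poly_on_closed_Un[OF W(1) X(1) V(1)] V(2) by simp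
  have bridges: "all_bridges (E \<inter> W \<times> W)" using W.connected_card_edges(2)[OF W(2,3) EW] .
  \<comment> \<open>Used twice: against the triangle in (i), and for linear \<open>q\<close> in
    (iv).\<close>
  have regular_even: "even (card X)" if reg: "\<And>u. u \<in> X \<Longrightarrow> deg u = 2"
  proof -
    have r0: "restr X (\<lambda>_. 1) \<noteq> (\<lambda>u. 0 :: rat)" using X(2) by (auto simp: restr_def fun_eq_iff)
    have eig: "adjop V E (restr X (\<lambda>_. 1)) u = (2 * restr X (\<lambda>_. 1) u :: rat)" for u
      using reg by (simp add: X.adjop_W_one) (simp add: restr_def)
    have "poly (char_poly_on E X) 2 = 0"
      unfolding X.poly_char_poly_on_iff using eig r0
      by (intro exI[of _ "restr X (\<lambda>_. 1)"]) (auto simp: restr_def fun_eq_iff)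
    then have "poly (char_poly_on E V) (- 2) = 0" using sym by (simp add: cpV)
    then consider "poly (char_poly_on E W) (- 2) = 0" | "poly (char_poly_on E X) (- 2) = 0" by (auto simp: cpV)
    then show ?thesis
    proof cases
      case 1
      obtain col :: "'v \<Rightarrow> bool" where "\<forall>(u, v) \<in> E \<inter> W \<times> W. col u \<noteq> col v"
        using sgraph.two_colouring[OF W.sgraph_induced bridges] by blast
      then have W2: "poly (char_poly_on E W) 2 = 0"
        using W.two_colouring_symmetric_spectrum[OF _ 1, of col] by auto
      \<comment> \<open>The indicator of \<open>X\<close> is an eigenvector for 2 that
        \<open>q\<close> annihilates, so 2 is a root of \<open>q\<close>.\<close>
      obtain x where "x \<in> X" using X(2) by auto
      then have "poly (of_int_poly q) (2 :: rat) = 0"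
        using fun_cong[OF qX, of x] pact_eigen[OF eig, of "of_int_poly q" x] by (simp add: restr_def)
      moreover obtain a b where "a * of_int_poly q + b * char_poly_on E W = 1"
        using irreducible_bezout[OF q] by blast
      then have "poly (a * of_int_poly q + b * char_poly_on E W) 2 = 1" by simp
      ultimately show ?thesis using W2 by simp
    next
      case 2
      then show ?thesis using X.two_regular_even[OF X(3) reg] by blast
    qed
  qed
  have nW: "card W \<ge> 1" and nX: "card X \<ge> 1"
    using W(2) X(2) W.finite_W X.finite_W by (simp_all add: Suc_le_eq card_gt_0_iff)
  have wW1: "walks V E W 1 = 2 * of_nat (card W) - 2"
  proof -
    have "of_nat (card (E \<inter> W \<times> W) + 2) = (of_nat (2 * card W) :: rat)" using EW by simp
    then show ?thesis unfolding W.walks_1 by simp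
  qed
  have wX1: "walks V E X 1 = 2 * of_nat (card X)" unfolding X.walks_1 EX by simp
  have sum_deg: "(\<Sum>u\<in>X. deg u) = 2 * card X" using X.card_induced EX by simp
  \<comment> \<open>Average degree 2 with all degrees at most \<open>card X - 1\<close> rules out
    one and two vertices and makes three vertices a triangle, which is 2-regular of odd
    order.\<close>
  have "card X \<ge> 4"
  proof (rule ccontr)
    assume "\<not> card X \<ge> 4"
    have le: "deg u \<le> card X - 1" if "u \<in> X" for u
    proof -
      have "{v \<in> V. (u, v) \<in> E} \<subseteq> X - {u}" using X.closed that E_D by blast
      then have "deg u \<le> card (X - {u})" using X.finite_W by (intro card_mono) auto
      then show ?thesis using that by simp
    qed
    have "2 * card X \<le> (\<Sum>u\<in>X. card X - 1)"
      unfolding sum_deg[symmetric] using le by (rule sum_mono)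
    then have "2 * card X \<le> card X * (card X - 1)" by simp
    moreover have "card X = 1 \<or> card X = 2 \<or> card X = 3" using nX \<open>\<not> card X \<ge> 4\<close> by linarith
    ultimately have X3: "card X = 3" by auto
    have "deg u = 2" if "u \<in> X" for u
    proof (rule ccontr)
      assume "deg u \<noteq> 2"
      then have "deg u < 2" using le[OF that] X3 by simp
      moreover have "\<forall>v\<in>X. deg v \<le> 2" using le X3 by simp
      ultimately have "(\<Sum>u\<in>X. deg u) < (\<Sum>u\<in>X. 2)"
        using X.finite_W that by (intro sum_strict_mono_ex1) blast+
      then show False using sum_deg by simp
    qed
    then have "even (card X)" by (rule regular_even)
    then show False using X3 by simp
  qed
  moreover have "walks V E W 2 \<ge> 4 * of_nat (card W) - 6"
  proof -
    have "d\<^sup>2 \<ge> 3 * d - 2" for d :: int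
    proof -
      have "(d - 1) * (d - 2) \<ge> 0" by (cases "d \<le> 1") (simp_all add: mult_nonpos_nonpos)
      then show ?thesis by (simp add: power2_eq_square algebra_simps)
    qed
    \<comment> \<open>With 2n - 2 arcs the bound is 3(2n - 2) - 2n = 4n - 6.\<close>
    from W.walks_2_ge[of 3 2, OF this] show ?thesis
      using wW1 unfolding W.walks_1 by simp
  qed
  moreover have "walks V E X 2 \<ge> 4 * of_nat (card X)"
  proof -
    have "d\<^sup>2 \<ge> 4 * d - 4" for d :: int
      using zero_le_power2[of "d - 2"] by (simp add: power2_eq_square algebra_simps)
    from X.walks_2_ge[of 4 4, OF this] show ?thesis
      using wX1 unfolding X.walks_1 by simp
  qed
  moreover have "walks V E W 2 \<ge> 0" unfolding W.walks_2 by (rule of_nat_0_le_iff)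
  moreover have "even (card (E \<inter> W \<times> W))" using EW by presburger
  then have "even_rat (walks V E W 2)" by (rule W.even_walks_2)
  moreover have "even_rat (walks V E X 2)" using EX by (intro X.even_walks_2) simp
  moreover have "(a, walks V E W 0) \<in> {(0, 1), (1, 2)}" if p: "p = [:- a, 1:]" for a
  proof -
    \<comment> \<open>The recurrence at index 0 reads 2n - 2 = a n, so n divides 2.\<close>
    have "pact (\<lambda>s k. s (Suc k)) (of_int_poly p) (walks V E W) 0 = 0"
      using W.walks_recurrence[OF pW] by simp
    then have "walks V E W 1 = of_int a * walks V E W 0"
      by (simp add: p pact_pCons)
    then have "of_int (2 * int (card W) - 2) = (of_int (a * int (card W)) :: rat)"
      unfolding wW1 W.walks_0 by simp
    then have eq: "(2 - a) * int (card W) = 2" unfolding of_int_eq_iff by (simp add: algebra_simps)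
    then have "int (card W) dvd 2" using dvd_triv_right[of "int (card W)" "2 - a"] by simp
    then have "int (card W) \<le> 2" by (rule zdvd_imp_le) simp
    then have "card W = 1 \<or> card W = 2" using nW by linarith
    then show ?thesis using eq by (auto simp: W.walks_0)
  qed
  moreover have "a = 2 \<and> even_rat (walks V E X 0)" if q': "q = [:- a, 1:]" for a
  proof -
    have "pact (\<lambda>s k. s (Suc k)) (of_int_poly q) (walks V E X) 0 = 0"
      using X.walks_recurrence[OF qX] by simp
    then have "walks V E X 1 = of_int a * walks V E X 0"
      by (simp add: q' pact_pCons)
    then have "of_int (2 * int (card X)) = (of_int (a * int (card X)) :: rat)"
      unfolding wX1 X.walks_0 by simp
    then have a: "a = 2" unfolding of_int_eq_iff using nX by simp
    have "deg u = 2" if "u \<in> X" for u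
    proof -
      have "pact (adjop V E) (of_int_poly q) (restr X (\<lambda>_. 1)) u = (0 :: rat)" using qX by simp
      then have "adjop V E (restr X (\<lambda>_. 1)) u = (2 :: rat)"
        using that by (simp add: q' a pact_pCons restr_def)
      then have "of_nat (deg u) = (of_nat 2 :: rat)" using that by (simp add: X.adjop_W_one)
      then show ?thesis by (simp only: of_nat_eq_iff)
    qed
    then have "even (card X)" by (rule regular_even)
    then have "even_rat (walks V E X 0)"
      unfolding even_rat_def X.walks_0 by (intro exI[of _ "int (card X)"]) simp
    then show ?thesis using a by simp
  qed
  moreover have "walks V E W 1 - 2 * walks V E W 0 = - 2" "walks V E X 1 - 2 * walks V E X 0 = 0"
    unfolding wW1 wX1 W.walks_0 X.walks_0 by simp_all
  ultimately show ?thesis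
    unfolding moment_conditions_def
    using W.walks_nat X.walks_nat nW by (simp add: W.walks_0 X.walks_0)
qed

end


section \<open>From the tree to a generalized cospectral graph\<close>

lemma monic_irreducible_not_dvd:
  fixes F G :: "rat poly"
  assumes "irreducible F" "irreducible G" "lead_coeff F = 1" "lead_coeff G = 1" "F \<noteq> G"
  shows "\<not> F dvd G"
proof
  assume "F dvd G"
  then obtain k where k: "G = F * k" by (rule dvdE)
  have "is_unit k" using irreducibleD[OF assms(2) k] assms(1) by (auto simp: irreducible_def)
  then obtain c where "k = [:c:]" unfolding is_unit_poly_iff by blast
  then have "G = Polynomial.smult c F" using k by simp
  then show False using assms(3-5) by (cases "c = 0") auto
qed

lemma (in pair_graph) char_poly_on_adjacency: "char_poly_on (parcs G) (pverts G) = char_poly (adjacency_matrix G)"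
  unfolding adjacency_matrix_mat_of[OF pair_finite_verts]
  by (rule char_poly_on_eq[OF vertex_list(1,2)[OF pair_finite_verts]])

lemma (in sgraph) even_card_E: "even (card E)"
proof (induction rule: edge_induct)
  case (insert F u v)
  then show ?case using sgraph.card_delete_edge[OF insert(2,3)] by simp
qed simp

lemma (in sgraph_closed) walks_add:
  assumes "sgraph_closed V E X" "W \<inter> X = {}" "W \<union> X = V"
  shows "walks V E V k = walks V E W k + walks V E X k"
proof -
  interpret linear_op "adjop V E :: ('v \<Rightarrow> rat) \<Rightarrow> 'v \<Rightarrow> rat" by (rule linear_op_adjop)
  have "restr V (\<lambda>_. 1) = (\<lambda>u. restr W (\<lambda>_. 1) u + restr X (\<lambda>_. 1) u :: rat)"
    using assms(2,3) by (auto simp: restr_def fun_eq_iff)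
  then show ?thesis unfolding walks_def by (simp add: linear_op.add[OF funpow] sum.distrib)
qed

text \<open>
  The squared norm of \<open>P(A) 1\<close> is the walk-count functional of \<open>P\<^sup>2\<close>.
\<close>

lemma annihilates_transfer:
  fixes P :: "rat poly"
  assumes "sgraph V E" "sgraph V' E'" and walks: "walks V E V = walks V' E' V'"
    and ann: "pact (adjop V E) P (restr V (\<lambda>_. 1)) = (\<lambda>u. 0)"
  shows "pact (adjop V' E') P (restr V' (\<lambda>_. 1)) = (\<lambda>u. 0)"
proof -
  interpret T: sgraph V E by fact
  interpret H: sgraph V' E' by fact
  interpret Tc: sgraph_closed V E V by (rule T.sgraph_closed_V)
  interpret Hc: sgraph_closed V' E' V' by (rule H.sgraph_closed_V)
  interpret LT: linear_op "adjop V E :: ('a \<Rightarrow> rat) \<Rightarrow> 'a \<Rightarrow> rat" by (rule linear_op_adjop)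
  interpret LH: linear_op "adjop V' E' :: ('b \<Rightarrow> rat) \<Rightarrow> 'b \<Rightarrow> rat" by (rule linear_op_adjop)
  let ?r = "restr V' (\<lambda>_. 1) :: 'b \<Rightarrow> rat"
  define z where "z = pact (adjop V' E') P ?r"
  have "pact (adjop V E) (P * P) (restr V (\<lambda>_. 1)) = (\<lambda>u. 0)"
    unfolding LT.pact_mult ann by simp
  from Tc.walks_recurrence[OF this]
  have "0 = pact (\<lambda>s k. s (Suc k)) (P * P) (walks V' E' V') 0" unfolding walks by simp
  also have "\<dots> = (\<Sum>u\<in>V'. pact (adjop V' E') (P * P) ?r u)"
    using LH.sum_pact_funpow[where V = V' and k = 0 and p = "P * P" and x = ?r] by (simp add: walks_def[abs_def])
  also have "\<dots> = (\<Sum>u\<in>V'. pact (adjop V' E') P z u * ?r u)"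
    unfolding LH.pact_mult z_def by (simp add: restr_def[of V' "\<lambda>_. 1"])
  also have "\<dots> = (\<Sum>u\<in>V'. z u * z u)"
    unfolding H.pact_self_adjoint z_def ..
  finally have "\<forall>u\<in>V'. z u = 0" using H.finite_V by (simp add: sum_nonneg_eq_0_iff)
  moreover have "z u = 0" if "u \<notin> V'" for u
    using that unfolding z_def Hc.pact_restr by (simp add: restr_def)
  ultimately show ?thesis unfolding z_def by auto
qed

text \<open>Uniqueness of partial fractions on the level of moments: the difference
  \<open>s - s'\<close>, which equals \<open>t' - t\<close>, is annihilated by both of the coprime
  polynomials.\<close>

lemma coprime_recurrences_unique:
  fixes F G :: "rat poly" and s s' t t' :: "nat \<Rightarrow> rat"
  assumes FG: "a * F + b * G = 1" and sum: "\<And>k. s k + t k = s' k + t' k"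
    and s: "pact (\<lambda>s k. s (Suc k)) F s = (\<lambda>k. 0)" "pact (\<lambda>s k. s (Suc k)) F s' = (\<lambda>k. 0)"
    and t: "pact (\<lambda>s k. s (Suc k)) G t = (\<lambda>k. 0)" "pact (\<lambda>s k. s (Suc k)) G t' = (\<lambda>k. 0)"
  shows "s = s'" "t = t'"
proof -
  define S where "S = (\<lambda>(s :: nat \<Rightarrow> rat) k. s (Suc k))"
  define d where "d = (\<lambda>k. s k - s' k)"
  interpret linear_op S unfolding S_def by (rule linear_op_shift)
  note st = s[folded S_def] t[folded S_def]
  have D: "pact S p (\<lambda>k. x k - y k) = (\<lambda>k. pact S p x k - pact S p y k)" for p x y
    by (rule linear_op.diff[OF pact_linear])
  have F: "pact S F d = (\<lambda>k. 0)" unfolding d_def D st by simp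
  have "d k = t' k - t k" for k using sum[of k] unfolding d_def by linarith
  then have "d = (\<lambda>k. t' k - t k)" by (rule ext)
  then have "pact S G d = (\<lambda>k. 0)" by (simp add: D st)
  with F have "d = (\<lambda>k. 0)" using FG by (rule pact_coprime)
  then have eq: "s k = s' k" for k unfolding d_def by (simp add: fun_eq_iff)
  show "s = s'" using eq by (rule ext)
  show "t = t'"
  proof
    show "t k = t' k" for k using sum[of k] eq[of k] by simp
  qed
qed

theorem corollary4p4:
  fixes T :: "'a pair_pre_digraph"
    and f g :: "int poly"
    and \<Gamma>f \<Gamma>g :: "rat poly fract"
  assumes "is_tree T"
    and "main_factor_multiplicity T = 2"
    and "main_poly T = of_int_poly (f * g)"
    and "f \<noteq> g"
    and "lead_coeff f = 1"
    and "lead_coeff g = 1"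
    and "irreducible (of_int_poly f :: rat poly)"
    and "irreducible (of_int_poly g :: rat poly)"
    and "factor_coronal_decomposition T f g \<Gamma>f \<Gamma>g"
    and "\<not> moment_conditions f (moment \<Gamma>f) g (moment \<Gamma>g)"
    and "\<not> moment_conditions g (moment \<Gamma>g) f (moment \<Gamma>f)"
  shows "\<forall>H :: 'b pair_pre_digraph. pair_graph H \<and> generalized_cospectral T H \<longrightarrow> is_tree H"
proof (intro allI impI, elim conjE)
  fix H :: "'b pair_pre_digraph"
  assume H: "pair_graph H" and cosp: "generalized_cospectral T H"
  have T: "pair_graph T" and T_ne: "pverts T \<noteq> {}"
    and T_conn: "\<And>u v. u \<in> pverts T \<Longrightarrow> v \<in> pverts T \<Longrightarrow> (u, v) \<in> (parcs T)\<^sup>*"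
    and T_br: "all_bridges (parcs T)"
    using \<open>is_tree T\<close> unfolding is_tree_iff by auto
  interpret T: pair_graph T by (rule T)
  interpret H: pair_graph H by (rule H)
  interpret Ts: sgraph "pverts T" "parcs T" by (rule T.sgraph)
  interpret Tc: sgraph_closed "pverts T" "parcs T" "pverts T" by (rule Ts.sgraph_closed_V)
  let ?V = "pverts H" and ?E = "parcs H"
  interpret Hs: sgraph ?V ?E by (rule H.sgraph)
  interpret Hc: sgraph_closed ?V ?E ?V by (rule Hs.sgraph_closed_V)
  note gc = generalized_cospectral_coronal[OF T H cosp]
  note cpT = T.char_poly_on_adjacency
  have cpTH: "char_poly_on (parcs T) (pverts T) = char_poly_on ?E ?V" unfolding cpT H.char_poly_on_adjacency by (rule gc(1))
  have walks: "walks (pverts T) (parcs T) (pverts T) = walks ?V ?E ?V"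
    using moment_coronal[OF T] moment_coronal[OF H] gc(3) by (simp add: fun_eq_iff)
  have EV: "parcs T \<inter> pverts T \<times> pverts T = parcs T" "?E \<inter> ?V \<times> ?V = ?E"
    using Ts.E_V Hs.E_V by auto
  have "card (parcs T) + 2 = 2 * card (pverts T)"
    using Ts.card_edges_all_bridges[OF T_br] Ts.comps_connected[OF T_ne T_conn] by simp
  moreover have "card (parcs T) = card ?E"
    using fun_cong[OF walks, of 1] unfolding Tc.walks_1 Hc.walks_1 EV by simp
  ultimately have cardE: "card ?E + 2 = 2 * card ?V" using gc(2) by simp
  have V_ne: "?V \<noteq> {}" using gc(2) T_ne Ts.finite_V by (metis card_0_eq card.empty)
  show "is_tree H"
  proof (cases "\<forall>u\<in>?V. \<forall>v\<in>?V. (u, v) \<in> ?E\<^sup>*")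
    case True
    then show ?thesis
      unfolding is_tree_iff using H V_ne Hs.connected_all_bridgesI[OF V_ne _ cardE] by blast
  next
    case False
    then obtain u0 v0 where uv: "u0 \<in> ?V" "v0 \<in> ?V" "(u0, v0) \<notin> ?E\<^sup>*" by blast
    let ?F = "of_int_poly f :: rat poly" and ?G = "of_int_poly g :: rat poly"
    have FG: "of_int_poly (f * g) = ?F * ?G" by (simp add: of_int_poly_hom.hom_mult)
    have "pact (adjop ?V ?E) (?F * ?G) (restr ?V (\<lambda>_. 1)) = (\<lambda>u. 0)"
      using annihilates_transfer[OF T.sgraph H.sgraph walks T.main_poly_annihilates[OF assms(3)]]
      unfolding FG .
    then have two: "two_main_factors ?V ?E ?F ?G"
      using assms(7,8) T.main_factors_simple[OF assms(2-8)]
      unfolding two_main_factors_def two_main_factors_axioms_def cpTH[symmetric] cpT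
      using H.sgraph by auto
    interpret two_main_factors ?V ?E ?F ?G by (rule two)
    \<comment> \<open>The component of \<open>u0\<close> and its complement may carry the factors in
      either order; \<open>W\<close> names the one that carries \<open>?F\<close>.\<close>
    have parts: "\<exists>W X. sgraph_closed ?V ?E W \<and> sgraph_closed ?V ?E X \<and> W \<noteq> {} \<and> X \<noteq> {} \<and>
        W \<inter> X = {} \<and> W \<union> X = ?V \<and> ?F dvd char_poly_on ?E W \<and> ?G dvd char_poly_on ?E X"
    proof -
      let ?C = "?E\<^sup>* `` {u0}"
      have C: "sgraph_closed ?V ?E ?C" using Hs.sgraph_closed_component[OF uv(1)] .
      have D: "sgraph_closed ?V ?E (?V - ?C)" by (rule Hs.sgraph_closed_Diff[OF Hs.sgraph_closed_V C])
      have ne: "?C \<noteq> {}" "?V - ?C \<noteq> {}" "?C \<inter> (?V - ?C) = {}" "(?V - ?C) \<inter> ?C = {}"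
        "?C \<union> (?V - ?C) = ?V" "(?V - ?C) \<union> ?C = ?V"
        using uv sgraph_closed.W_V[OF C] by (simp_all, blast+)
      show ?thesis
      proof (cases "?G dvd char_poly_on ?E (?V - ?C)")
        case True
        have "?F dvd char_poly_on ?E ?C" by (rule other_part(1)[OF C ne(1) D ne(3) True])
        then show ?thesis
          by (intro exI[of _ ?C] exI[of _ "?V - ?C"] conjI C D ne True)
      next
        case False
        then have F: "?F dvd char_poly_on ?E (?V - ?C)" using factor_dvd_char_poly_on(1)[OF D ne(2)] by blast
        have "?G dvd char_poly_on ?E ?C"
          by (rule two_main_factors.other_part(1)[OF flip C ne(1) D ne(3) F])
        then show ?thesis
          by (intro exI[of _ "?V - ?C"] exI[of _ ?C] conjI C D ne F)
      qed
    qed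
    then obtain W X where W: "sgraph_closed ?V ?E W" "W \<noteq> {}" and X: "sgraph_closed ?V ?E X" "X \<noteq> {}"
      and WX: "W \<inter> X = {}" "W \<union> X = ?V" and dvd: "?F dvd char_poly_on ?E W" "?G dvd char_poly_on ?E X" by blast
    have XW: "X \<inter> W = {}" "X \<union> W = ?V" using WX by auto
    note Wp = other_part[OF W X(1) WX(1) dvd(2)]
    note Xp = two_main_factors.other_part[OF flip X W(1) XW(1) dvd(1)]
    interpret W: sgraph_closed ?V ?E W by (rule W(1))
    interpret X: sgraph_closed ?V ?E X by (rule X(1))
    have nFG: "\<not> ?F dvd ?G"
      using assms(4-8) by (intro monic_irreducible_not_dvd) auto
    obtain a b where bez: "a * ?F + b * ?G = 1" using irreducible_bezout[OF assms(7) nFG] .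
    obtain A B where dec: "coronal T = \<Gamma>f + \<Gamma>g" "\<Gamma>f = Fract A ?F" "\<Gamma>g = Fract B ?G"
      using assms(9) unfolding factor_coronal_decomposition_def by auto
    have "?F \<noteq> 0" "?G \<noteq> 0" using assms(7,8) by (auto simp: irreducible_def)
    note rec = moment_Fract_recurrence[OF this(1), of A] moment_Fract_recurrence[OF this(2), of B]
    have sum: "moment \<Gamma>f k + moment \<Gamma>g k = walks ?V ?E W k + walks ?V ?E X k" for k
      using moment_coronal[OF T, of k] walks W.walks_add[OF X(1) WX, of k] dec(1)
      by (simp add: moment_add)
    \<comment> \<open>The factor moments satisfy the recurrences because of their denominators, the
      walk counts because of the annihilation.\<close>
    have mom: "moment \<Gamma>f = walks ?V ?E W" "moment \<Gamma>g = walks ?V ?E X"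
      using coprime_recurrences_unique[OF bez sum _ W.walks_recurrence[OF Wp(3)] _ X.walks_recurrence[OF Xp(3)]]
        rec unfolding dec(2,3) by blast+
    \<comment> \<open>\<open>T\<close> is bipartite, whereas \<open>H\<close> is not known to be;
      the symmetry passes through the common characteristic polynomial.\<close>
    have sym: "poly (char_poly_on ?E ?V) (- 2) = 0" if "poly (char_poly_on ?E ?V) 2 = 0"
    proof -
      obtain col :: "'a \<Rightarrow> bool" where "\<forall>(u, v) \<in> parcs T. col u \<noteq> col v"
        using Ts.two_colouring[OF T_br] by blast
      then show ?thesis
        using Tc.two_colouring_symmetric_spectrum[of col 2] that unfolding cpTH by auto
    qed
    have "card (?E \<inter> W \<times> W) + card (?E \<inter> X \<times> X) = card ?E"
    proof -
      have E: "?E = (?E \<inter> W \<times> W) \<union> (?E \<inter> X \<times> X)" using Hs.E_V W.closed X.closed WX by auto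
      have "(?E \<inter> W \<times> W) \<inter> (?E \<inter> X \<times> X) = {}" using WX(1) by blast
      then show ?thesis
        using card_Un_disjoint[of "?E \<inter> W \<times> W" "?E \<inter> X \<times> X"] Hs.finite_E
        unfolding E[symmetric] by simp
    qed
    moreover have "card W + card X = card ?V"
      using card_Un_disjoint[OF W.finite_W X.finite_W WX(1)] WX(2) by simp
    moreover have "2 * card W \<le> card (?E \<inter> W \<times> W) + 2" "2 * card X \<le> card (?E \<inter> X \<times> X) + 2"
      using W.connected_card_edges(1)[OF W(2) Wp(4)] X.connected_card_edges(1)[OF X(2) Xp(4)] by auto
    \<comment> \<open>The surpluses of the two arc counts over the tree value 2n - 2 are nonnegative
      and add up to 2; evenness excludes 1 + 1.\<close>
    moreover obtain e where "card (?E \<inter> W \<times> W) = 2 * e"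
      using sgraph.even_card_E[OF W.sgraph_induced] by (rule evenE)
    ultimately consider "card (?E \<inter> W \<times> W) + 2 = 2 * card W" "card (?E \<inter> X \<times> X) = 2 * card X"
      | "card (?E \<inter> X \<times> X) + 2 = 2 * card X" "card (?E \<inter> W \<times> W) = 2 * card W"
      using cardE by (cases "e < card W") linarith+
    then show ?thesis
    proof cases
      case 1
      have "moment_conditions f (walks ?V ?E W) g (walks ?V ?E X)"
        by (rule Hs.moment_conditionsI[OF W Wp(4) X Xp(4) WX assms(8) Wp(2,3) Xp(3) 1 sym])
      then show ?thesis using assms(10) mom by simp
    next
      case 2
      have "moment_conditions g (walks ?V ?E X) f (walks ?V ?E W)"
        by (rule Hs.moment_conditionsI[OF X Xp(4) W Wp(4) XW assms(7) Xp(2,3) Wp(3) 2 sym])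
      then show ?thesis using assms(11) mom by simp
    qed
  qed
qed

end
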